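(* Let $G$ be a finite group. Let $f,g:G\to G$ be modelled as random oracles (independent, uniformly random functions), let $k=(k^L,k^R)\in G^2$ have independent, uniformly random subkeys, let $\Psi=\Psi_k^{f,g}$ with $\Psi_k^{f,g}(x)=\mathcal{F}_{g,f,f,g}(x\cdot k)\cdot k$ for $x\in G^2$, and let $R$ be a uniformly random permutation of $G^2$. Then, for any $4$-oracle adversary $\mathcal{A}$ with at most $q$ total queries, we have $$\left| \Pr\left[ \mathcal{A}^{\Psi,\Psi^{-1},f,g} = 1\right] - \Pr\left[ \mathcal{A}^{R,R^{-1},f,g} = 1\right] \right| \leq 2(3q^2-2q)|G|^{-1} + (q^2-q)|G|^{-2}.$$
   Context: $G$ is not necessarily abelian. For $\phi:G\to G$ let $\mathcal{F}_\phi:G\times G\to G\times G$, $(x,y)\mapsto (y,x\cdot \phi(y))$ (one Group Feistel round), and $\mathcal{F}_{\phi_1,\phi_2,\phi_3,\phi_4}=\mathcal{F}_{\phi_4}\circ\mathcal{F}_{\phi_3}\circ\mathcal{F}_{\phi_2}\circ\mathcal{F}_{\phi_1}$. For $x=(x^L,x^R)$, $k=(k^L,k^R)\in G^2$, $x\cdot k=(x^L\cdot k^L,x^R\cdot k^R)$. The adversary is an adaptive, computationally unbounded oracle algorithm outputting a bit; $q$ counts all queries to its four oracles. The probabilities are over $f,g,k$ (respectively $f,g,R$, with $R$ independent of $f,g$) and the coins of $\mathcal{A}$. *)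

theory Defs
  imports
    "HOL-Probability.Probability_Mass_Function"
    "HOL-Combinatorics.Permutations"
    "HOL-Algebra.Group"
begin

definition feistel :: "('g, 'm) monoid_scheme \<Rightarrow> ('g \<Rightarrow> 'g) \<Rightarrow> 'g \<times> 'g \<Rightarrow> 'g \<times> 'g" where
  "feistel G \<phi> = (\<lambda>(x, y). (y, x \<otimes>\<^bsub>G\<^esub> \<phi> y))"

definition feistel4 ::
  "('g, 'm) monoid_scheme \<Rightarrow> ('g \<Rightarrow> 'g) \<Rightarrow> ('g \<Rightarrow> 'g) \<Rightarrow> ('g \<Rightarrow> 'g) \<Rightarrow> ('g \<Rightarrow> 'g)
     \<Rightarrow> 'g \<times> 'g \<Rightarrow> 'g \<times> 'g" where
  "feistel4 G \<phi>1 \<phi>2 \<phi>3 \<phi>4 = feistel G \<phi>4 \<circ> feistel G \<phi>3 \<circ> feistel G \<phi>2 \<circ> feistel G \<phi>1"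

definition Psi ::
  "('g, 'm) monoid_scheme \<Rightarrow> ('g \<Rightarrow> 'g) \<Rightarrow> ('g \<Rightarrow> 'g) \<Rightarrow> 'g \<times> 'g \<Rightarrow> 'g \<times> 'g \<Rightarrow> 'g \<times> 'g" where
  "Psi G f g k x = feistel4 G g f f g (x \<otimes>\<^bsub>G \<times>\<times> G\<^esub> k) \<otimes>\<^bsub>G \<times>\<times> G\<^esub> k"

text \<open>
  A computationally unbounded, adaptive, randomized oracle algorithm is given by its
  interaction tree. It queries one of four oracles (a permutation of pairs, the inverse of
  that permutation, and two functions on the group) and continues depending on the answer;
  \<open>Coin p\<close> draws the rest of the algorithm from an arbitrary discrete distribution.
\<close>

datatype 'g algorithm =
    Output bool
  | Query_perm "'g \<times> 'g" "'g \<times> 'g \<Rightarrow> 'g algorithm"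
  | Query_inv "'g \<times> 'g" "'g \<times> 'g \<Rightarrow> 'g algorithm"
  | Query_f 'g "'g \<Rightarrow> 'g algorithm"
  | Query_g 'g "'g \<Rightarrow> 'g algorithm"
  | Coin "'g algorithm pmf"

primrec run ::
  "('g \<times> 'g \<Rightarrow> 'g \<times> 'g) \<Rightarrow> ('g \<times> 'g \<Rightarrow> 'g \<times> 'g) \<Rightarrow> ('g \<Rightarrow> 'g) \<Rightarrow> ('g \<Rightarrow> 'g)
     \<Rightarrow> 'g algorithm \<Rightarrow> bool pmf" where
  "run P P' f g (Output b) = return_pmf b"
| "run P P' f g (Query_perm x c) = run P P' f g (c (P x))"
| "run P P' f g (Query_inv x c) = run P P' f g (c (P' x))"
| "run P P' f g (Query_f u c) = run P P' f g (c (f u))"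
| "run P P' f g (Query_g u c) = run P P' f g (c (g u))"
| "run P P' f g (Coin p) = join_pmf (map_pmf (run P P' f g) p)"

text \<open>
  \<open>adversary G q A\<close>: \<open>A\<close> makes at most \<open>q\<close> queries in total, all of them inside the group.
  Since oracle answers always lie in the group, continuations are only constrained there.
\<close>

inductive adversary :: "('g, 'm) monoid_scheme \<Rightarrow> nat \<Rightarrow> 'g algorithm \<Rightarrow> bool" for G where
  Output: "adversary G q (Output b)"
| Query_perm: "adversary G (Suc q) (Query_perm x c)"
    if "x \<in> carrier (G \<times>\<times> G)" "\<And>y. y \<in> carrier (G \<times>\<times> G) \<Longrightarrow> adversary G q (c y)"
| Query_inv: "adversary G (Suc q) (Query_inv x c)"
    if "x \<in> carrier (G \<times>\<times> G)" "\<And>y. y \<in> carrier (G \<times>\<times> G) \<Longrightarrow> adversary G q (c y)"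
| Query_f: "adversary G (Suc q) (Query_f u c)"
    if "u \<in> carrier G" "\<And>v. v \<in> carrier G \<Longrightarrow> adversary G q (c v)"
| Query_g: "adversary G (Suc q) (Query_g u c)"
    if "u \<in> carrier G" "\<And>v. v \<in> carrier G \<Longrightarrow> adversary G q (c v)"
| Coin: "adversary G q (Coin p)"
    if "\<And>A. A \<in> set_pmf p \<Longrightarrow> adversary G q A"

definition random_function :: "('g, 'm) monoid_scheme \<Rightarrow> ('g \<Rightarrow> 'g) pmf" where
  "random_function G = pmf_of_set (carrier G \<rightarrow>\<^sub>E carrier G)"

definition random_permutation :: "('g, 'm) monoid_scheme \<Rightarrow> ('g \<times> 'g \<Rightarrow> 'g \<times> 'g) pmf" where
  "random_permutation G = pmf_of_set {R. R permutes carrier (G \<times>\<times> G)}"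

definition Psi_game :: "('g, 'm) monoid_scheme \<Rightarrow> 'g algorithm \<Rightarrow> bool pmf" where
  "Psi_game G A = do {
     f \<leftarrow> random_function G;
     g \<leftarrow> random_function G;
     kL \<leftarrow> pmf_of_set (carrier G);
     kR \<leftarrow> pmf_of_set (carrier G);
     let P = Psi G f g (kL, kR);
     run P (inv_into (carrier (G \<times>\<times> G)) P) f g A
   }"

definition random_game :: "('g, 'm) monoid_scheme \<Rightarrow> 'g algorithm \<Rightarrow> bool pmf" where
  "random_game G A = do {
     f \<leftarrow> random_function G;
     g \<leftarrow> random_function G;
     R \<leftarrow> random_permutation G;
     run R (inv_into (carrier (G \<times>\<times> G)) R) f g A
   }"

text \<open>The use of \<^const>\<open>inv_into\<close> for the inverse oracle is justified as follows.\<close>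

lemma bij_betw_feistel:
  assumes "group G" and \<phi>: "\<phi> \<in> carrier G \<rightarrow> carrier G"
  shows "bij_betw (feistel G \<phi>) (carrier (G \<times>\<times> G)) (carrier (G \<times>\<times> G))"
proof -
  interpret group G by fact
  show ?thesis
    by (rule bij_betw_byWitness[where f' = "\<lambda>(a, b). (b \<otimes>\<^bsub>G\<^esub> inv\<^bsub>G\<^esub> (\<phi> a), a)"])
      (use \<phi> in \<open>auto simp: feistel_def Pi_iff m_assoc\<close>)
qed

lemma bij_betw_Psi:
  assumes G: "group G"
    and f: "f \<in> carrier G \<rightarrow> carrier G" and g: "g \<in> carrier G \<rightarrow> carrier G"
    and k: "k \<in> carrier (G \<times>\<times> G)"
  shows "bij_betw (Psi G f g k) (carrier (G \<times>\<times> G)) (carrier (G \<times>\<times> G))"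
proof -
  interpret D: group "G \<times>\<times> G" using G by (rule DirProd_group[OF _ G])
  have k_bij: "bij_betw (\<lambda>x. x \<otimes>\<^bsub>G \<times>\<times> G\<^esub> k) (carrier (G \<times>\<times> G)) (carrier (G \<times>\<times> G))"
    by (rule bij_betw_byWitness[where f' = "\<lambda>x. x \<otimes>\<^bsub>G \<times>\<times> G\<^esub> inv\<^bsub>G \<times>\<times> G\<^esub> k"])
      (use k in \<open>auto simp: D.m_assoc simp del: carrier_DirProd mult_DirProd inv_DirProd one_DirProd\<close>)
  have "Psi G f g k = (\<lambda>x. x \<otimes>\<^bsub>G \<times>\<times> G\<^esub> k) \<circ> feistel G g \<circ> feistel G f \<circ> feistel G f
      \<circ> feistel G g \<circ> (\<lambda>x. x \<otimes>\<^bsub>G \<times>\<times> G\<^esub> k)"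
    by (simp add: fun_eq_iff Psi_def feistel4_def)
  then show ?thesis
    by (auto intro!: bij_betw_trans k_bij bij_betw_feistel G f g simp del: carrier_DirProd)
qed

end

theory Submission
  imports Defs "HOL-Probability.Product_PMF"
begin

text \<open>
  This is the H-coefficient technique. A transcript records \<open>p\<close> answers of the permutation, \<open>a\<close>
  of \<open>f\<close> and \<open>b\<close> of \<open>g\<close>. If every transcript with \<open>p + a + b \<le> q\<close> is at least \<open>1 - \<epsilon>\<close> times as
  likely under the cipher as under a random permutation, then so is either output of the
  adversary, and the distinguishing advantage is at most \<open>\<epsilon>\<close>.

  Let \<open>N\<close> be the order of the group. In the ideal world a transcript has probability at most
  \<open>N\<^sup>-\<^sup>a\<^sup>-\<^sup>b (N\<^sup>2 - p)! / (N\<^sup>2)!\<close>. In the real world, a key is bad if the outer rounds evaluate \<open>g\<close> at a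
  recorded point, or at a common point from both sides: probability at most \<open>(2pb + p\<^sup>2) / N\<close>.
  For a good key, the outer values of \<open>g\<close> are fresh, so with probability at least
  \<open>1 - (2pa + 3p\<^sup>2 - 2p) / N\<close> the \<open>2p\<close> inputs of the inner rounds are distinct and not recorded
  for \<open>f\<close>; then the transcript prescribes exactly \<open>a + 2p\<close> values of \<open>f\<close>.
\<close>

section \<open>Worlds, transcripts and the H-coefficient argument\<close>

text \<open>Behaviour is constrained on the carrier only, so that one set contains both the
  permutations drawn in the ideal game and the cipher, which need not be the identity
  elsewhere.\<close>

definition worlds :: "('g, 'm) monoid_scheme \<Rightarrow> (('g \<Rightarrow> 'g) \<times> ('g \<Rightarrow> 'g) \<times> ('g \<times> 'g \<Rightarrow> 'g \<times> 'g)) set" where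
  "worlds G = {(f, g, P). f \<in> carrier G \<rightarrow> carrier G \<and> g \<in> carrier G \<rightarrow> carrier G
     \<and> bij_betw P (carrier (G \<times>\<times> G)) (carrier (G \<times>\<times> G))}"

definition play ::
  "('g, 'm) monoid_scheme \<Rightarrow> 'g algorithm
     \<Rightarrow> ('g \<Rightarrow> 'g) \<times> ('g \<Rightarrow> 'g) \<times> ('g \<times> 'g \<Rightarrow> 'g \<times> 'g) \<Rightarrow> bool pmf" where
  "play G A = (\<lambda>(f, g, P). run P (inv_into (carrier (G \<times>\<times> G)) P) f g A)"

definition agrees :: "('a \<times> 'b) set \<Rightarrow> ('a \<Rightarrow> 'b) \<Rightarrow> bool" where
  "agrees R h \<longleftrightarrow> (\<forall>(u, v) \<in> R. h u = v)"

text \<open>A transcript is kept as three sets: the order of the queries is forgotten, and a forward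
  query at \<open>x\<close> answered by \<open>y\<close> leaves the same trace as an inverse query
  at \<open>y\<close> answered by \<open>x\<close>.\<close>

definition consistent ::
  "(('g \<times> 'g) \<times> ('g \<times> 'g)) set \<Rightarrow> ('g \<times> 'g) set \<Rightarrow> ('g \<times> 'g) set
     \<Rightarrow> (('g \<Rightarrow> 'g) \<times> ('g \<Rightarrow> 'g) \<times> ('g \<times> 'g \<Rightarrow> 'g \<times> 'g)) set" where
  "consistent D E H = {(f, g, P). agrees D P \<and> agrees E f \<and> agrees H g}"

text \<open>
  \<open>weight G M b T A\<close> is the probability, for a world drawn from \<open>M\<close>, that the world lies in \<open>T\<close>
  and \<open>A\<close> outputs \<open>b\<close> in it.
\<close>

definition weight where
  "weight G M b T A = (\<Sum>w\<in>set_pmf M \<inter> T. pmf M w * pmf (play G A w) b)"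

text \<open>Serves all four kinds of query: \<open>val w\<close> is the answer that the world
  \<open>w\<close> gives to the first query of \<open>A\<close>, and \<open>c\<close> is the
  continuation.\<close>

lemma weight_split:
  assumes "finite (set_pmf M)" "finite Y"
    and "\<And>w. w \<in> set_pmf M \<Longrightarrow> val w \<in> Y"
    and "\<And>w. w \<in> set_pmf M \<Longrightarrow> play G A w = play G (c (val w)) w"
  shows "weight G M b T A = (\<Sum>y\<in>Y. weight G M b (T \<inter> {w. val w = y}) (c y))"
proof -
  have "weight G M b T A
      = (\<Sum>y\<in>Y. \<Sum>w\<in>{w \<in> set_pmf M \<inter> T. val w = y}. pmf M w * pmf (play G A w) b)"
    unfolding weight_def by (rule sum.group[symmetric]) (use assms in auto)
  also have "\<dots> = (\<Sum>y\<in>Y. weight G M b (T \<inter> {w. val w = y}) (c y))"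
    unfolding weight_def by (intro sum.cong) (use assms(4) in auto)
  finally show ?thesis .
qed

lemma weight_Output:
  assumes "finite (set_pmf M)"
  shows "weight G M b T (Output b') = (if b = b' then measure_pmf.prob M T else 0)"
proof -
  have "measure_pmf.prob M T = measure_pmf.prob M (T \<inter> set_pmf M)"
    by (rule measure_Int_set_pmf[symmetric])
  also have "\<dots> = sum (pmf M) (T \<inter> set_pmf M)"
    using assms by (intro measure_measure_pmf_finite) auto
  finally show ?thesis
    by (auto simp: weight_def play_def case_prod_beta Int_commute)
qed

lemma integrable_weight: "integrable (measure_pmf p) (\<lambda>A. weight G M b T A)"
  unfolding weight_def
  by (intro Bochner_Integration.integrable_sum integrable_mult_right measure_pmf.integrable_const_bound[where B = 1])
    (auto simp: pmf_le_1)

lemma weight_Coin: "weight G M b T (Coin p) = (\<integral>A. weight G M b T A \<partial>measure_pmf p)"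
proof -
  have int: "integrable (measure_pmf p) (\<lambda>A. pmf (play G A w) b)" for w
    by (intro measure_pmf.integrable_const_bound[where B = 1]) (auto simp: pmf_le_1)
  have "pmf (play G (Coin p) w) b = (\<integral>A. pmf (play G A w) b \<partial>measure_pmf p)" for w
    by (simp add: play_def pmf_join case_prod_beta)
  then show ?thesis
    using int by (simp add: weight_def Bochner_Integration.integral_sum)
qed

lemma weight_UNIV:
  assumes "finite (set_pmf M)"
  shows "weight G M b UNIV A = pmf (bind_pmf M (play G A)) b"
  unfolding weight_def pmf_bind
  by (subst integral_measure_pmf[of "set_pmf M"]) (use assms in auto)

lemma consistent_insert:
  "consistent (insert (x, y) D) E H = consistent D E H \<inter> {w. snd (snd w) x = y}"
  "consistent D (insert (u, v) E) H = consistent D E H \<inter> {w. fst w u = v}"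
  "consistent D E (insert (u, v) H) = consistent D E H \<inter> {w. fst (snd w) u = v}"
  by (auto simp: consistent_def agrees_def)

text \<open>Induction on the adversary, over all transcripts recorded so far. A query splits both
  weights into sums over the possible answers; each answer adds at most one pair to the transcript
  and lowers the remaining budget \<open>r\<close> by one. At an output the weight is 0 or the
  probability of the transcript, where \<open>le\<close> applies. Coins average the
  inequality.\<close>

lemma weight_le_weight:
  fixes G :: "('g, 'm) monoid_scheme"
  defines "X \<equiv> carrier (G \<times>\<times> G)" and "C \<equiv> carrier G"
  assumes fin: "finite C"
    and M: "finite (set_pmf M)" "set_pmf M \<subseteq> worlds G"
    and M': "finite (set_pmf M')" "set_pmf M' \<subseteq> worlds G"
    and le: "\<And>D E H. D \<subseteq> X \<times> X \<Longrightarrow> E \<subseteq> C \<times> C \<Longrightarrow> H \<subseteq> C \<times> C \<Longrightarrow> card D + card E + card H \<le> q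
      \<Longrightarrow> \<alpha> * measure_pmf.prob M (consistent D E H) \<le> measure_pmf.prob M' (consistent D E H)"
    and "adversary G r A"
    and "D \<subseteq> X \<times> X" "E \<subseteq> C \<times> C" "H \<subseteq> C \<times> C" "card D + card E + card H + r \<le> q"
  shows "\<alpha> * weight G M b (consistent D E H) A \<le> weight G M' b (consistent D E H) A"
  using assms(9-13)
proof (induction arbitrary: D E H)
  case (Output r b')
  then show ?case
    using le[of D E H] by (auto simp: weight_Output M M')
next
  case (Query_perm x r c)
  have fX: "finite X" using fin by (simp add: X_def C_def)
  have xX: "x \<in> X" using Query_perm by (simp add: X_def)
  define val :: "('g \<Rightarrow> 'g) \<times> ('g \<Rightarrow> 'g) \<times> ('g \<times> 'g \<Rightarrow> 'g \<times> 'g) \<Rightarrow> 'g \<times> 'g"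
    where "val = (\<lambda>(f, g, P). P x)"
  have split: "weight G N b (consistent D E H) (Query_perm x c)
      = (\<Sum>y\<in>X. weight G N b (consistent (insert (x, y) D) E H) (c y))"
    if "finite (set_pmf N)" "set_pmf N \<subseteq> worlds G" for N
  proof (subst weight_split[where val = val and Y = X and c = c])
    show "val w \<in> X" if "w \<in> set_pmf N" for w
      using that \<open>set_pmf N \<subseteq> worlds G\<close> xX
      unfolding val_def worlds_def X_def by (auto dest!: subsetD bij_betwE simp del: carrier_DirProd)
  qed (use that fX in \<open>auto simp: val_def play_def consistent_insert case_prod_beta\<close>)
  have "\<alpha> * weight G M b (consistent (insert (x, y) D) E H) (c y)
      \<le> weight G M' b (consistent (insert (x, y) D) E H) (c y)" if "y \<in> X" for y
  proof (rule Query_perm.IH)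
    show "y \<in> carrier (G \<times>\<times> G)" using that by (simp add: X_def)
    show "card (insert (x, y) D) + card E + card H + r \<le> q"
      \<comment> \<open>A repeated query leaves the transcript unchanged, so its size grows by at
        most one.\<close>
      using card_insert_le_m1[of "Suc (card D)" D "(x, y)"] Query_perm.prems by simp
  qed (use that xX Query_perm.prems in auto)
  then show ?case
    by (simp add: split M M' sum_distrib_left sum_mono)
next
  case (Query_inv y r c)
  have fX: "finite X" using fin by (simp add: X_def C_def)
  have yX: "y \<in> X" using Query_inv by (simp add: X_def)
  define val :: "('g \<Rightarrow> 'g) \<times> ('g \<Rightarrow> 'g) \<times> ('g \<times> 'g \<Rightarrow> 'g \<times> 'g) \<Rightarrow> 'g \<times> 'g"
    where "val = (\<lambda>(f, g, P). inv_into X P y)"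
  have split: "weight G N b (consistent D E H) (Query_inv y c)
      = (\<Sum>x\<in>X. weight G N b (consistent (insert (x, y) D) E H) (c x))"
    if "finite (set_pmf N)" "set_pmf N \<subseteq> worlds G" for N
  proof (subst weight_split[where val = val and Y = X and c = c])
    have bij: "bij_betw (snd (snd w)) X X" if "w \<in> set_pmf N" for w
      using that \<open>set_pmf N \<subseteq> worlds G\<close> by (auto simp: worlds_def X_def simp del: carrier_DirProd)
    show "val w \<in> X" if "w \<in> set_pmf N" for w
      using bij[OF that] yX by (auto simp: val_def bij_betw_def inv_into_into split: prod.splits)
    \<comment> \<open>For a bijection, the answer \<open>x\<close> to the inverse query means
      exactly that \<open>x\<close> is sent to \<open>y\<close>; the splitting thus records the same
      pairs as for forward queries.\<close>
    have "val w = x \<longleftrightarrow> snd (snd w) x = y" if "w \<in> set_pmf N" "x \<in> X" for w x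
      using bij[OF that(1)] yX that(2)
      by (auto simp: val_def bij_betw_inv_into_left bij_betw_inv_into_right split: prod.splits)
    then show "(\<Sum>x\<in>X. weight G N b (consistent D E H \<inter> {w. val w = x}) (c x))
        = (\<Sum>x\<in>X. weight G N b (consistent (insert (x, y) D) E H) (c x))"
      by (auto simp: weight_def consistent_insert intro!: sum.cong)
  qed (use that fX in \<open>auto simp: val_def play_def case_prod_beta X_def\<close>)
  have "\<alpha> * weight G M b (consistent (insert (x, y) D) E H) (c x)
      \<le> weight G M' b (consistent (insert (x, y) D) E H) (c x)" if "x \<in> X" for x
  proof (rule Query_inv.IH)
    show "x \<in> carrier (G \<times>\<times> G)" using that by (simp add: X_def)
    show "card (insert (x, y) D) + card E + card H + r \<le> q"
      using card_insert_le_m1[of "Suc (card D)" D "(x, y)"] Query_inv.prems by simp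
  qed (use that yX Query_inv.prems in auto)
  then show ?case
    by (simp add: split M M' sum_distrib_left sum_mono)
next
  case (Query_f u r c)
  define val :: "('g \<Rightarrow> 'g) \<times> ('g \<Rightarrow> 'g) \<times> ('g \<times> 'g \<Rightarrow> 'g \<times> 'g) \<Rightarrow> 'g"
    where "val = (\<lambda>(f, g, P). f u)"
  have split: "weight G N b (consistent D E H) (Query_f u c)
      = (\<Sum>v\<in>C. weight G N b (consistent D (insert (u, v) E) H) (c v))"
    if "finite (set_pmf N)" "set_pmf N \<subseteq> worlds G" for N
    by (subst weight_split[where val = val and Y = C and c = c])
      (use that fin Query_f in \<open>auto simp: val_def play_def consistent_insert case_prod_beta C_def worlds_def Pi_iff\<close>)
  have "\<alpha> * weight G M b (consistent D (insert (u, v) E) H) (c v)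
      \<le> weight G M' b (consistent D (insert (u, v) E) H) (c v)" if "v \<in> C" for v
  proof (rule Query_f.IH)
    show "v \<in> carrier G" using that by (simp add: C_def)
    show "card D + card (insert (u, v) E) + card H + r \<le> q"
      using card_insert_le_m1[of "Suc (card E)" E "(u, v)"] Query_f.prems by simp
  qed (use that Query_f in \<open>auto simp: C_def\<close>)
  then show ?case
    by (simp add: split M M' sum_distrib_left sum_mono)
next
  case (Query_g u r c)
  define val :: "('g \<Rightarrow> 'g) \<times> ('g \<Rightarrow> 'g) \<times> ('g \<times> 'g \<Rightarrow> 'g \<times> 'g) \<Rightarrow> 'g"
    where "val = (\<lambda>(f, g, P). g u)"
  have split: "weight G N b (consistent D E H) (Query_g u c)
      = (\<Sum>v\<in>C. weight G N b (consistent D E (insert (u, v) H)) (c v))"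
    if "finite (set_pmf N)" "set_pmf N \<subseteq> worlds G" for N
    by (subst weight_split[where val = val and Y = C and c = c])
      (use that fin Query_g in \<open>auto simp: val_def play_def consistent_insert case_prod_beta C_def worlds_def Pi_iff\<close>)
  have "\<alpha> * weight G M b (consistent D E (insert (u, v) H)) (c v)
      \<le> weight G M' b (consistent D E (insert (u, v) H)) (c v)" if "v \<in> C" for v
  proof (rule Query_g.IH)
    show "v \<in> carrier G" using that by (simp add: C_def)
    show "card D + card E + card (insert (u, v) H) + r \<le> q"
      using card_insert_le_m1[of "Suc (card H)" H "(u, v)"] Query_g.prems by simp
  qed (use that Query_g in \<open>auto simp: C_def\<close>)
  then show ?case
    by (simp add: split M M' sum_distrib_left sum_mono)
next
  case (Coin p r)
  have "(\<integral>A. \<alpha> * weight G M b (consistent D E H) A \<partial>measure_pmf p)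
      \<le> (\<integral>A. weight G M' b (consistent D E H) A \<partial>measure_pmf p)"
  proof (rule integral_mono_AE)
    show "AE A in measure_pmf p. \<alpha> * weight G M b (consistent D E H) A \<le> weight G M' b (consistent D E H) A"
      using Coin.IH Coin.prems by (simp add: AE_measure_pmf_iff)
  qed (rule integrable_mult_right integrable_weight)+
  then show ?case
    by (simp add: weight_Coin)
qed

text \<open>The multiplicative loss becomes an additive \<open>\<epsilon>\<close> because
  probabilities are at most 1. A lower bound for each of the two outputs suffices, since the bound
  for \<open>False\<close> is an upper bound for \<open>True\<close>.\<close>

lemma H_coefficient:
  fixes G :: "('g, 'm) monoid_scheme"
  defines "X \<equiv> carrier (G \<times>\<times> G)" and "C \<equiv> carrier G"
  assumes fin: "finite C"
    and M: "finite (set_pmf M)" "set_pmf M \<subseteq> worlds G"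
    and M': "finite (set_pmf M')" "set_pmf M' \<subseteq> worlds G"
    and le: "\<And>D E H. D \<subseteq> X \<times> X \<Longrightarrow> E \<subseteq> C \<times> C \<Longrightarrow> H \<subseteq> C \<times> C \<Longrightarrow> card D + card E + card H \<le> q
      \<Longrightarrow> (1 - \<epsilon>) * measure_pmf.prob M (consistent D E H) \<le> measure_pmf.prob M' (consistent D E H)"
    and A: "adversary G q A" and "0 \<le> \<epsilon>"
  shows "\<bar>pmf (bind_pmf M' (play G A)) True - pmf (bind_pmf M (play G A)) True\<bar> \<le> \<epsilon>"
proof -
  have univ: "consistent {} {} {} = (UNIV :: (('g \<Rightarrow> 'g) \<times> ('g \<Rightarrow> 'g) \<times> ('g \<times> 'g \<Rightarrow> 'g \<times> 'g)) set)"
    by (auto simp: consistent_def agrees_def)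
  have *: "pmf (bind_pmf M (play G A)) b - \<epsilon> \<le> pmf (bind_pmf M' (play G A)) b" for b
  proof -
    have "(1 - \<epsilon>) * weight G M b (consistent {} {} {}) A \<le> weight G M' b (consistent {} {} {}) A"
      by (rule weight_le_weight[where q = q and r = q])
        (use M M' A fin le in \<open>simp_all add: X_def C_def del: carrier_DirProd\<close>)
    moreover have "\<epsilon> * pmf (bind_pmf M (play G A)) b \<le> \<epsilon> * 1"
      using \<open>0 \<le> \<epsilon>\<close> by (intro mult_left_mono pmf_le_1)
    ultimately show ?thesis
      by (simp add: univ weight_UNIV M M' algebra_simps)
  qed
  show ?thesis
    using *[of True] *[of False] by (simp add: pmf_False_conv_True)
qed

section \<open>Random functions and permutations that agree with a finite relation\<close>

lemma card_eq_card_Domain: "single_valued R \<Longrightarrow> card (Domain R) = card R"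
  unfolding fst_eq_Domain[symmetric]
  by (intro card_image) (auto simp: single_valued_def inj_on_def)

text \<open>The functions that agree with \<open>R\<close> form a product set: a point of
  \<open>Domain R\<close> has one admissible value, any other point has \<open>card C\<close>. As
  \<open>R\<close> is single-valued, \<open>card R\<close> points are prescribed.\<close>

lemma prob_agrees:
  assumes "finite C" "R \<subseteq> C \<times> C" "single_valued R" "C \<noteq> {}"
  shows "measure_pmf.prob (pmf_of_set (C \<rightarrow>\<^sub>E C)) {h. agrees R h} = 1 / real (card C) ^ card R"
proof -
  have sub: "Domain R \<subseteq> C" using assms by auto
  have R: "R `` {u} = {v}" if "(u, v) \<in> R" for u v
    using assms(3) that by (auto simp: single_valued_def)
  have "(C \<rightarrow>\<^sub>E C) \<inter> {h. agrees R h} = (\<Pi>\<^sub>E u\<in>C. if u \<in> Domain R then R `` {u} else C)"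
  proof (intro equalityI subsetI)
    fix h assume "h \<in> (C \<rightarrow>\<^sub>E C) \<inter> {h. agrees R h}"
    then show "h \<in> (\<Pi>\<^sub>E u\<in>C. if u \<in> Domain R then R `` {u} else C)"
      by (auto simp: PiE_iff agrees_def)
  next
    fix h assume h: "h \<in> (\<Pi>\<^sub>E u\<in>C. if u \<in> Domain R then R `` {u} else C)"
    have "h u \<in> (if u \<in> Domain R then R `` {u} else C)" if "u \<in> C" for u
      using h that by (rule PiE_mem)
    then have "h u = v" if "(u, v) \<in> R" for u v
      using that R[OF that] sub by (metis Domain.DomainI singletonD subsetD)
    moreover have "h u \<in> C" if "u \<in> C" for u
      using PiE_mem[OF h that] assms(2) by (auto split: if_splits)
    ultimately show "h \<in> (C \<rightarrow>\<^sub>E C) \<inter> {h. agrees R h}"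
      using h by (auto simp: agrees_def PiE_iff)
  qed
  then have "card ((C \<rightarrow>\<^sub>E C) \<inter> {h. agrees R h})
      = card (\<Pi>\<^sub>E u\<in>C. if u \<in> Domain R then R `` {u} else C)"
    by (rule arg_cong)
  also have "\<dots> = (\<Prod>u\<in>C. card (if u \<in> Domain R then R `` {u} else C))"
    using assms(1) by (rule card_PiE)
  also have "\<dots> = (\<Prod>u\<in>C. if u \<in> Domain R then 1 else card C)"
  proof (intro prod.cong refl)
    fix u
    show "card (if u \<in> Domain R then R `` {u} else C) = (if u \<in> Domain R then 1 else card C)"
      using R by auto
  qed
  also have "\<dots> = card C ^ card (C - Domain R)"
    using assms(1) by (simp add: prod.If_cases Diff_eq)
  also have "card (C - Domain R) = card C - card R"
    using assms sub by (simp add: card_Diff_subset finite_subset card_eq_card_Domain)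
  finally have c: "card ((C \<rightarrow>\<^sub>E C) \<inter> {h. agrees R h}) = card C ^ (card C - card R)" .
  have "card R \<le> card C"
    using card_mono[OF assms(1) sub] card_eq_card_Domain[OF assms(3)] by simp
  moreover have "(C \<rightarrow>\<^sub>E C) \<noteq> {}" "finite (C \<rightarrow>\<^sub>E C)"
    using assms by (auto simp: PiE_eq_empty_iff intro!: finite_PiE)
  moreover have "card C > 0" using assms by (simp add: card_gt_0_iff)
  moreover from this have "real (card C) ^ (card C - card R) = real (card C) ^ card C / real (card C) ^ card R"
    using \<open>card R \<le> card C\<close> by (intro power_diff) auto
  ultimately show ?thesis
    using assms(1,4) by (simp add: measure_pmf_of_set c card_PiE)
qed

lemma agreesD: "agrees R h \<Longrightarrow> (u, v) \<in> R \<Longrightarrow> h u = v"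
  by (auto simp: agrees_def)

lemma single_valued_if_agrees: "agrees R h \<Longrightarrow> single_valued R"
  by (intro single_valuedI) (metis agreesD)

lemma prob_agrees_le:
  assumes "finite C" "R \<subseteq> C \<times> C" "C \<noteq> {}"
  shows "measure_pmf.prob (pmf_of_set (C \<rightarrow>\<^sub>E C)) {h. agrees R h} \<le> 1 / real (card C) ^ card R"
proof (cases "single_valued R")
  case False
  then have "{h. agrees R h} = {}"
    using single_valued_if_agrees by blast
  then show ?thesis by simp
qed (simp add: prob_agrees assms)

lemma prob_agrees_insert:
  assumes "finite C" "C \<noteq> {}" "H \<subseteq> C \<times> C" "single_valued H" "u \<in> C" "v \<in> C" "u \<notin> Domain H"
  shows "measure_pmf.prob (pmf_of_set (C \<rightarrow>\<^sub>E C)) {h. agrees H h \<and> h u = v} = 1 / real (card C) ^ card H / real (card C)"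
proof -
  have "{h. agrees H h \<and> h u = v} = {h. agrees (insert (u, v) H) h}"
    by (auto simp: agrees_def)
  moreover have "single_valued (insert (u, v) H)" "(u, v) \<notin> H"
    using assms by (auto simp: single_valued_def)
  moreover have "finite H" using assms finite_subset by blast
  ultimately show ?thesis
    using assms by (simp add: prob_agrees)
qed

text \<open>A relation between two fresh values costs as much as one prescribed value: each of the N
  possible values of \<open>h u'\<close> also fixes \<open>h u\<close>, so the event is covered by N
  events that prescribe two further values each.\<close>

lemma prob_agrees_rel:
  assumes C: "finite C" "C \<noteq> {}" and H: "H \<subseteq> C \<times> C" "single_valued H"
    and u: "u \<in> C" "u \<notin> Domain H" and u': "u' \<in> C" "u' \<notin> Domain H" and "u \<noteq> u'"
    and \<psi>: "\<And>v. v \<in> C \<Longrightarrow> \<psi> v \<in> C"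
  shows "measure_pmf.prob (pmf_of_set (C \<rightarrow>\<^sub>E C)) {h. agrees H h \<and> h u = \<psi> (h u')}
    \<le> 1 / real (card C) ^ card H / real (card C)"
proof -
  let ?M = "pmf_of_set (C \<rightarrow>\<^sub>E C)"
  have N: "card C > 0" using C by (simp add: card_gt_0_iff)
  have fH: "finite H" using C H finite_subset by blast
  have "(C \<rightarrow>\<^sub>E C) \<noteq> {}" "finite (C \<rightarrow>\<^sub>E C)"
    using C by (auto simp: PiE_eq_empty_iff intro!: finite_PiE)
  then have M: "set_pmf ?M = (C \<rightarrow>\<^sub>E C)" by simp
  have "measure_pmf.prob ?M {h. agrees H h \<and> h u = \<psi> (h u')}
      = measure_pmf.prob ?M ({h. agrees H h \<and> h u = \<psi> (h u')} \<inter> set_pmf ?M)"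
    by (rule measure_Int_set_pmf[symmetric])
  also have "\<dots> \<le> measure_pmf.prob ?M (\<Union>v\<in>C. {h. agrees (insert (u', v) H) h \<and> h u = \<psi> v})"
    using u' by (intro measure_pmf.finite_measure_mono) (auto simp: agrees_def M)
  also have "\<dots> \<le> (\<Sum>v\<in>C. measure_pmf.prob ?M {h. agrees (insert (u', v) H) h \<and> h u = \<psi> v})"
    using C by (intro measure_UNION_le) auto
  also have "\<dots> = (\<Sum>v\<in>C. 1 / real (card C) ^ Suc (card H) / real (card C))"
  proof (intro sum.cong refl)
    fix v assume "v \<in> C"
    have "single_valued (insert (u', v) H)" "(u', v) \<notin> H"
      using H u' by (auto simp: single_valued_def)
    then show "measure_pmf.prob ?M {h. agrees (insert (u', v) H) h \<and> h u = \<psi> v}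
        = 1 / real (card C) ^ Suc (card H) / real (card C)"
      using C H u u' \<psi> \<open>v \<in> C\<close> \<open>u \<noteq> u'\<close> fH by (subst prob_agrees_insert) auto
  qed
  also have "\<dots> = 1 / real (card C) ^ card H / real (card C)"
    using N by simp
  finally show ?thesis .
qed

text \<open>If some permutation \<open>R0\<close> agrees with \<open>D\<close>, composition with its
  inverse maps the agreeing permutations injectively to those that fix \<open>Domain D\<close>, i.e.
  to permutations of \<open>card X - card D\<close> points. If there is none, the probability is
  0.\<close>

lemma prob_permutation_agrees_le:
  assumes X: "finite X" and D: "D \<subseteq> X \<times> X"
  shows "measure_pmf.prob (pmf_of_set {R. R permutes X}) {R. agrees D R} \<le> fact (card X - card D) / fact (card X)"
proof (cases "\<exists>R0. R0 permutes X \<and> agrees D R0")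
  case False
  have "id \<in> {R. R permutes X}" by (simp add: permutes_id)
  then have "{R. R permutes X} \<noteq> {}" by blast
  with False X have "measure_pmf.prob (pmf_of_set {R. R permutes X}) {R. agrees D R} = 0"
    by (auto simp: measure_pmf_zero_iff finite_permutations)
  then show ?thesis by simp
next
  case True
  then obtain R0 where R0: "R0 permutes X" "agrees D R0" by blast
  have "single_valued D" using R0(2) by (rule single_valued_if_agrees)
  then have card: "card (X - Domain D) = card X - card D"
    using X D by (subst card_Diff_subset) (auto simp: card_eq_card_Domain intro: finite_subset[OF _ X])
  have "card ({R. R permutes X} \<inter> {R. agrees D R}) \<le> card {p. p permutes (X - Domain D)}"
  proof (rule card_inj_on_le[where f = "\<lambda>R. inv_into UNIV R0 \<circ> R"])
    show "inj_on (\<lambda>R. inv_into UNIV R0 \<circ> R) ({R. R permutes X} \<inter> {R. agrees D R})"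
      by (rule inj_on_inverseI[where g = "\<lambda>R. R0 \<circ> R"])
        (simp add: o_assoc permutes_inv_o(1)[OF R0(1)])
    show "(\<lambda>R. inv_into UNIV R0 \<circ> R) ` ({R. R permutes X} \<inter> {R. agrees D R}) \<subseteq> {p. p permutes (X - Domain D)}"
    proof clarsimp
      fix R assume R: "R permutes X" "agrees D R"
      have "inv_into UNIV R0 \<circ> R permutes X"
        using R R0 by (intro permutes_compose permutes_inv)
      moreover have "(inv_into UNIV R0 \<circ> R) x = x" if "x \<in> Domain D" for x
        using that agreesD[OF R(2)] agreesD[OF R0(2)] permutes_inverses(2)[OF R0(1)] by (metis DomainE comp_apply)
      ultimately show "inv_into UNIV R0 \<circ> R permutes X - Domain D"
        by (rule permutes_superset) auto
    qed
    show "finite {p. p permutes (X - Domain D)}" using X by (simp add: finite_permutations)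
  qed
  also have "\<dots> = fact (card X - card D)"
    using X by (subst card_permutations[OF refl]) (auto simp: card)
  finally have "real (card ({R. R permutes X} \<inter> {R. agrees D R})) \<le> fact (card X - card D)"
    by (metis of_nat_fact of_nat_le_iff)
  moreover have "{R. R permutes X} \<noteq> {}" using R0(1) by blast
  then have "measure_pmf.prob (pmf_of_set {R. R permutes X}) {R. agrees D R}
      = card ({R. R permutes X} \<inter> {R. agrees D R}) / fact (card X)"
    using X by (simp add: measure_pmf_of_set finite_permutations card_permutations)
  ultimately show ?thesis by (simp add: divide_right_mono)
qed

text \<open>Compares sampling without and with replacement. The quotient is the reciprocal of the
  falling product of n, n - 1, ..., n - p + 1, so this is a Bernoulli-type bound for the product of
  the factors 1 - i / n, obtained one factor at a time.\<close>

lemma fact_quotient_le: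
  assumes "p \<le> n" "n > 0"
  shows "(1 - real p * (real p - 1) / n) * (fact (n - p) / fact n) \<le> 1 / real n ^ p"
  using assms(1)
proof (induction p)
  case (Suc p)
  define t where "t = (fact (n - Suc p) / fact n :: real)"
  have n: "fact (n - p) = (real n - real p) * fact (n - Suc p)"
    using Suc.prems fact_reduce[of "n - p", where 'a = real] by simp
  \<comment> \<open>After multiplication by n^2, the comparison of the coefficients for p + 1 and p
    reads p^2 <= n p + p^3; already p^2 <= p^3 for a natural number p.\<close>
  have "real p * real p \<le> real p * (real p * real p)"
    by (cases p) (auto intro!: mult_left_mono)
  moreover have "0 \<le> real n * real p"
    by simp
  ultimately have "real p * real p \<le> real n * real p + real p * (real p * real p)"
    by linarith
  then have "(1 - real (Suc p) * (real (Suc p) - 1) / n)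
      \<le> (1 - real p * (real p - 1) / n) * ((real n - real p) / n)"
    using assms(2) by (simp add: divide_simps) (simp add: algebra_simps)
  then have "(1 - real (Suc p) * (real (Suc p) - 1) / n) * t
      \<le> (1 - real p * (real p - 1) / n) * ((real n - real p) / n) * t"
    by (intro mult_right_mono) (auto simp: t_def)
  also have "\<dots> = (1 - real p * (real p - 1) / n) * (fact (n - p) / fact n) / n"
    by (simp add: n t_def mult_ac)
  also have "\<dots> \<le> 1 / real n ^ p / n"
    using Suc by (intro divide_right_mono) auto
  finally show ?case by (simp add: t_def mult.commute)
qed simp

subsection \<open>Transcripts of the cipher\<close>

lemma prob_pmf_mono:
  assumes "\<And>x. x \<in> set_pmf M \<Longrightarrow> P x \<Longrightarrow> Q x"
  shows "measure_pmf.prob M {x. P x} \<le> measure_pmf.prob M {x. Q x}"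
  using assms by (intro measure_pmf.finite_measure_mono_AE) (auto simp: AE_measure_pmf_iff)

lemma prob_Bex_le:
  assumes "finite I" "\<And>i. i \<in> I \<Longrightarrow> measure_pmf.prob M {x. P x \<and> Q i x} \<le> \<delta>"
  shows "measure_pmf.prob M {x. P x \<and> (\<exists>i\<in>I. Q i x)} \<le> real (card I) * \<delta>"
proof -
  have "measure_pmf.prob M {x. P x \<and> (\<exists>i\<in>I. Q i x)} = measure_pmf.prob M (\<Union>i\<in>I. {x. P x \<and> Q i x})"
    by (rule arg_cong) auto
  also have "\<dots> \<le> (\<Sum>i\<in>I. measure_pmf.prob M {x. P x \<and> Q i x})"
    using assms(1) by (intro measure_UNION_le) auto
  also have "\<dots> \<le> real (card I) * \<delta>"
    using assms(2) by (rule sum_bounded_above)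
  finally show ?thesis .
qed

lemma prob_disj_le:
  assumes "measure_pmf.prob M {x. P x \<and> Q x} \<le> a" "measure_pmf.prob M {x. P x \<and> R x} \<le> b"
  shows "measure_pmf.prob M {x. P x \<and> (Q x \<or> R x)} \<le> a + b"
proof -
  have "{x. P x \<and> (Q x \<or> R x)} = {x. P x \<and> Q x} \<union> {x. P x \<and> R x}" by auto
  then show ?thesis
    using measure_Un_le[of "{x. P x \<and> Q x}" "measure_pmf M" "{x. P x \<and> R x}"] assms by simp
qed

text \<open>First-stage outcomes outside \<open>P\<close> contribute at least 0, so the integrand
  dominates \<open>c\<close> times the indicator of \<open>P\<close>.\<close>

lemma prob_bind_pmf_ge:
  assumes "\<And>x. x \<in> set_pmf M \<Longrightarrow> P x \<Longrightarrow> c \<le> measure_pmf.prob (N x) S" "0 \<le> c"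
  shows "c * measure_pmf.prob M {x. P x} \<le> measure_pmf.prob (bind_pmf M N) S"
proof -
  have int: "integrable (measure_pmf M) (\<lambda>x. measure_pmf.prob (N x) S)"
    by (intro measure_pmf.integrable_const_bound[where B = 1]) auto
  have "ennreal (measure_pmf.prob (bind_pmf M N) S) = (\<integral>\<^sup>+x. ennreal (measure_pmf.prob (N x) S) \<partial>measure_pmf M)"
    by (simp flip: measure_pmf.emeasure_eq_measure)
  also have "\<dots> = ennreal (\<integral>x. measure_pmf.prob (N x) S \<partial>measure_pmf M)"
    using int by (intro nn_integral_eq_integral) auto
  finally have "measure_pmf.prob (bind_pmf M N) S = (\<integral>x. measure_pmf.prob (N x) S \<partial>measure_pmf M)"
    by (subst (asm) ennreal_inj) auto
  moreover have "(\<integral>x. c * indicator {x. P x} x \<partial>measure_pmf M) \<le> (\<integral>x. measure_pmf.prob (N x) S \<partial>measure_pmf M)"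
  proof (rule integral_mono_AE)
    show "integrable (measure_pmf M) (\<lambda>x. c * indicator {x. P x} x)"
      by (intro integrable_mult_right measure_pmf.integrable_const_bound[where B = 1]) auto
    show "AE x in measure_pmf M. c * indicator {x. P x} x \<le> measure_pmf.prob (N x) S"
      using assms by (auto simp: AE_measure_pmf_iff indicator_def)
  qed (rule int)
  ultimately show ?thesis by simp
qed

text \<open>
  If the cipher maps \<open>x\<close> to \<open>y\<close>, then \<open>inner_left\<close> at \<open>x\<close> and \<open>inner_right\<close> at \<open>y\<close> are the
  inputs of the second and third rounds, i.e. the two points at which \<open>f\<close> is evaluated.
\<close>

definition inner_left :: "('g, 'm) monoid_scheme \<Rightarrow> ('g \<Rightarrow> 'g) \<Rightarrow> 'g \<times> 'g \<Rightarrow> 'g \<times> 'g \<Rightarrow> 'g" where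
  "inner_left G g k x = fst x \<otimes>\<^bsub>G\<^esub> fst k \<otimes>\<^bsub>G\<^esub> g (snd x \<otimes>\<^bsub>G\<^esub> snd k)"

definition inner_right :: "('g, 'm) monoid_scheme \<Rightarrow> ('g \<Rightarrow> 'g) \<Rightarrow> 'g \<times> 'g \<Rightarrow> 'g \<times> 'g \<Rightarrow> 'g" where
  "inner_right G g k y
     = snd y \<otimes>\<^bsub>G\<^esub> inv\<^bsub>G\<^esub> (snd k) \<otimes>\<^bsub>G\<^esub> inv\<^bsub>G\<^esub> (g (fst y \<otimes>\<^bsub>G\<^esub> inv\<^bsub>G\<^esub> (fst k)))"

text \<open>The middle clause includes \<open>i = j\<close>: both inner rounds use the same
  \<open>f\<close>, so even the two inputs arising from one recorded pair must differ.\<close>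

definition good_function where
  "good_function G D E k g \<longleftrightarrow>
     (\<forall>i\<in>D. \<forall>e\<in>E. inner_left G g k (fst i) \<noteq> fst e \<and> inner_right G g k (snd i) \<noteq> fst e)
   \<and> (\<forall>i\<in>D. \<forall>j\<in>D. inner_left G g k (fst i) \<noteq> inner_right G g k (snd j))
   \<and> (\<forall>i\<in>D. \<forall>j\<in>D. i \<noteq> j \<longrightarrow> inner_left G g k (fst i) \<noteq> inner_left G g k (fst j)
        \<and> inner_right G g k (snd i) \<noteq> inner_right G g k (snd j))"

text \<open>For a recorded pair the first round evaluates \<open>g\<close> at the right half of the
  input times \<open>snd k\<close>, the last round at the left half of the output times the inverse
  of \<open>fst k\<close>. Recorded pairs may share an outer input on the same side; only clashes
  with \<open>H\<close> and between the sides are excluded.\<close>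

definition good_key where
  "good_key G D H k \<longleftrightarrow>
     (\<forall>i\<in>D. snd (fst i) \<otimes>\<^bsub>G\<^esub> snd k \<notin> Domain H \<and> fst (snd i) \<otimes>\<^bsub>G\<^esub> inv\<^bsub>G\<^esub> (fst k) \<notin> Domain H)
   \<and> (\<forall>i\<in>D. \<forall>j\<in>D. snd (fst i) \<otimes>\<^bsub>G\<^esub> snd k \<noteq> fst (snd j) \<otimes>\<^bsub>G\<^esub> inv\<^bsub>G\<^esub> (fst k))"

section \<open>Inner round functions that reproduce a transcript\<close>

context group begin

abbreviation "C \<equiv> carrier G"
abbreviation "unif \<equiv> pmf_of_set (C \<rightarrow>\<^sub>E C)"

text \<open>Write S and T for the two inner inputs. The hypotheses on \<open>f\<close> are the
  equations of the second and third rounds, solved for the values at S and T; the first and last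
  rounds hold by the choice of S and T.\<close>

lemma Psi_eqI:
  assumes "x \<in> C \<times> C" "y \<in> C \<times> C" "k \<in> C \<times> C" "g \<in> C \<rightarrow> C"
    and f: "f (inner_left G g k x) = inv (snd x \<otimes> snd k) \<otimes> inner_right G g k y"
      "f (inner_right G g k y) = inv (inner_left G g k x) \<otimes> (fst y \<otimes> inv (fst k))"
  shows "Psi G f g k x = y"
proof -
  obtain xL xR yL yR kL kR where xyk: "x = (xL, xR)" "y = (yL, yR)" "k = (kL, kR)"
    by (metis surj_pair)
  have mem: "xL \<in> C" "xR \<in> C" "yL \<in> C" "yR \<in> C" "kL \<in> C" "kR \<in> C"
    using assms xyk by auto
  have g: "g u \<in> C" if "u \<in> C" for u using assms that by auto
  define S T where "S = inner_left G g k x" and "T = inner_right G g k y"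
  have ST: "S \<in> C" "T \<in> C"
    using mem g by (auto simp: S_def T_def inner_left_def inner_right_def xyk)
  have "feistel G g (xL \<otimes> kL, xR \<otimes> kR) = (xR \<otimes> kR, S)"
    by (simp add: feistel_def S_def inner_left_def xyk)
  moreover have "feistel G f (xR \<otimes> kR, S) = (S, T)"
  proof -
    have "f S = inv (xR \<otimes> kR) \<otimes> T" using f(1) by (simp add: S_def T_def xyk)
    then have "T = xR \<otimes> kR \<otimes> f S" using mem ST by (metis inv_closed inv_solve_left m_closed)
    then show ?thesis by (simp add: feistel_def)
  qed
  moreover have "feistel G f (S, T) = (T, yL \<otimes> inv kL)"
  proof -
    have "f T = inv S \<otimes> (yL \<otimes> inv kL)" using f(2) by (simp add: S_def T_def xyk)
    then have "yL \<otimes> inv kL = S \<otimes> f T" using mem ST by (metis inv_closed inv_solve_left m_closed)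
    then show ?thesis by (simp add: feistel_def)
  qed
  moreover have "feistel G g (T, yL \<otimes> inv kL) = (yL \<otimes> inv kL, yR \<otimes> inv kR)"
    using mem g[of "yL \<otimes> inv kL"] by (simp add: feistel_def T_def inner_right_def xyk m_assoc)
  ultimately show ?thesis
    using mem by (simp add: Psi_def feistel4_def xyk m_assoc)
qed

lemma set_unif: "finite C \<Longrightarrow> set_pmf unif = (C \<rightarrow>\<^sub>E C)"
  by (rule set_pmf_of_set) (auto simp: PiE_eq_empty_iff intro!: finite_PiE)

lemma inner_closed:
  assumes "g \<in> C \<rightarrow> C" "k \<in> C \<times> C" "x \<in> C \<times> C"
  shows "inner_left G g k x \<in> C" "inner_right G g k x \<in> C"
  using assms by (auto simp: inner_left_def inner_right_def Pi_iff)

text \<open>Extend \<open>E\<close> by the values of \<open>f\<close> that \<open>Psi_eqI\<close>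
  demands at the inner inputs. Goodness of \<open>g\<close> excludes that one input arises in two
  ways, so the extension \<open>E'\<close> is single-valued, and every function that agrees with it
  reproduces the whole transcript.\<close>

lemma prob_Psi_agrees_ge:
  assumes fin: "finite C"
    and D: "D \<subseteq> (C \<times> C) \<times> (C \<times> C)" and E: "E \<subseteq> C \<times> C" "single_valued E"
    and k: "k \<in> C \<times> C" and g: "g \<in> C \<rightarrow> C" and good: "good_function G D E k g"
  shows "1 / real (card C) ^ (card E + 2 * card D)
    \<le> measure_pmf.prob unif {f. agrees E f \<and> agrees D (Psi G f g k)}"
proof -
  define l r where "l = (\<lambda>i::('a \<times> 'a) \<times> ('a \<times> 'a). inner_left G g k (fst i))"
    and "r = (\<lambda>i::('a \<times> 'a) \<times> ('a \<times> 'a). inner_right G g k (snd i))"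
  \<comment> \<open>The values that \<open>Psi_eqI\<close> forces on \<open>f\<close> at
    \<open>l i\<close> and \<open>r i\<close>.\<close>
  define l' r' where "l' = (\<lambda>i. inv (snd (fst i) \<otimes> snd k) \<otimes> r i)"
    and "r' = (\<lambda>i. inv (l i) \<otimes> (fst (snd i) \<otimes> inv (fst k)))"
  define E' where "E' = E \<union> ((\<lambda>i. (l i, l' i)) ` D \<union> (\<lambda>i. (r i, r' i)) ` D)"
  have finD: "finite D" "finite E"
    using D E fin by (auto intro: finite_subset)
  have lr: "l i \<in> C" "r i \<in> C" if "i \<in> D" for i
    using that D k g by (auto simp: l_def r_def intro!: inner_closed)
  have lr': "l' i \<in> C" "r' i \<in> C" if "i \<in> D" for i
    using that D k lr[OF that] by (auto simp: l'_def r'_def)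
  have "E' \<subseteq> C \<times> C"
    using E lr lr' by (auto simp: E'_def)
  moreover have "single_valued E'"
  proof (rule single_valuedI)
    have neq: "l i \<noteq> u" "r i \<noteq> u" if "i \<in> D" "(u, v) \<in> E" for i u v
      using good that by (fastforce simp: good_function_def l_def r_def)+
    have neq2: "l i \<noteq> r j" if "i \<in> D" "j \<in> D" for i j
      using good that by (auto simp: good_function_def l_def r_def)
    have inj: "l i = l j \<Longrightarrow> i = j" "r i = r j \<Longrightarrow> i = j" if "i \<in> D" "j \<in> D" for i j
      using good that unfolding good_function_def l_def r_def by blast+
    fix u v w assume "(u, v) \<in> E'" "(u, w) \<in> E'"
    then consider "(u, v) \<in> E" "(u, w) \<in> E" | i j where "i \<in> D" "j \<in> D" "u = l i" "u = l j" "v = l' i" "w = l' j"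
      | i j where "i \<in> D" "j \<in> D" "u = r i" "u = r j" "v = r' i" "w = r' j"
      using neq neq2 unfolding E'_def by (smt (verit, best) Pair_inject UnE image_iff)
    then show "v = w"
      using E(2) inj by cases (metis single_valuedD)+
  qed
  ultimately have "1 / real (card C) ^ card E' = measure_pmf.prob unif {f. agrees E' f}"
    using fin by (subst prob_agrees) auto
  \<comment> \<open>An upper bound suffices, because fewer prescribed values only make agreement
    more likely.\<close>
  moreover have "card E' \<le> card E + 2 * card D"
  proof -
    have "card E' \<le> card E + (card ((\<lambda>i. (l i, l' i)) ` D) + card ((\<lambda>i. (r i, r' i)) ` D))"
      unfolding E'_def by (meson add_left_mono card_Un_le le_trans)
    then show ?thesis
      using card_image_le[OF finD(1), of "\<lambda>i. (l i, l' i)"] card_image_le[OF finD(1), of "\<lambda>i. (r i, r' i)"]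
      by linarith
  qed
  then have "1 / real (card C) ^ (card E + 2 * card D) \<le> 1 / real (card C) ^ card E'"
    using fin by (intro divide_left_mono power_increasing mult_pos_pos zero_less_power)
      (auto simp: Suc_le_eq card_gt_0_iff)
  moreover have "measure_pmf.prob unif {f. agrees E' f}
      \<le> measure_pmf.prob unif {f. agrees E f \<and> agrees D (Psi G f g k)}"
  proof (rule prob_pmf_mono, rule conjI)
    fix f assume f: "agrees E' f"
    show "agrees E f" using f by (auto simp: agrees_def E'_def)
    have "Psi G f g k x = y" if xy: "(x, y) \<in> D" for x y
    proof (rule Psi_eqI)
      have "(l (x, y), l' (x, y)) \<in> E'" "(r (x, y), r' (x, y)) \<in> E'"
        using xy by (auto simp: E'_def)
      from this[THEN agreesD[OF f]]
      show "f (inner_left G g k x) = inv (snd x \<otimes> snd k) \<otimes> inner_right G g k y"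
        "f (inner_right G g k y) = inv (inner_left G g k x) \<otimes> (fst y \<otimes> inv (fst k))"
        by (simp_all add: l_def r_def l'_def r'_def)
    qed (use xy D k g in auto)
    then show "agrees D (Psi G f g k)" by (auto simp: agrees_def)
  qed
  ultimately show ?thesis by linarith
qed

lemma mult_inv_eq_iff:
  assumes "a \<in> C" "b \<in> C" "w \<in> C"
  shows "a \<otimes> inv w = b \<longleftrightarrow> w = inv b \<otimes> a"
  using assms by (metis inv_closed inv_inv inv_mult_group inv_solve_right m_closed)

section \<open>Collisions of inner inputs under a random \<open>g\<close>, for a fixed key\<close>

context
  fixes H :: "('a \<times> 'a) set" and k :: "'a \<times> 'a"
  assumes fin: "finite C" and H: "H \<subseteq> C \<times> C" "single_valued H" and k: "k \<in> C \<times> C"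
begin

text \<open>The equation determines the value of \<open>g\<close> at a point that \<open>H\<close>
  leaves free.\<close>

lemma prob_inner_left_eq_le:
  assumes x: "x \<in> C \<times> C" "snd x \<otimes> snd k \<notin> Domain H" and e: "e \<in> C"
  shows "measure_pmf.prob unif {g. agrees H g \<and> inner_left G g k x = e}
    \<le> 1 / real (card C) ^ card H / real (card C)"
proof -
  have "measure_pmf.prob unif {g. agrees H g \<and> inner_left G g k x = e}
      \<le> measure_pmf.prob unif {g. agrees H g \<and> g (snd x \<otimes> snd k) = inv (fst x \<otimes> fst k) \<otimes> e}"
    using x e k by (intro prob_pmf_mono)
      (auto simp: set_unif fin inner_left_def PiE_iff inv_solve_left)
  also have "\<dots> = 1 / real (card C) ^ card H / real (card C)"
    using x e k H fin by (intro prob_agrees_insert) auto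
  finally show ?thesis .
qed

lemma prob_inner_right_eq_le:
  assumes y: "y \<in> C \<times> C" "fst y \<otimes> inv (fst k) \<notin> Domain H" and e: "e \<in> C"
  shows "measure_pmf.prob unif {g. agrees H g \<and> inner_right G g k y = e}
    \<le> 1 / real (card C) ^ card H / real (card C)"
proof -
  have "measure_pmf.prob unif {g. agrees H g \<and> inner_right G g k y = e}
      \<le> measure_pmf.prob unif {g. agrees H g \<and> g (fst y \<otimes> inv (fst k)) = inv e \<otimes> (snd y \<otimes> inv (snd k))}"
  proof (rule prob_pmf_mono, elim conjE, rule conjI)
    fix g assume g: "g \<in> set_pmf unif" and eq: "inner_right G g k y = e"
    have "g (fst y \<otimes> inv (fst k)) \<in> C" using g y k by (auto simp: set_unif fin PiE_iff)
    then show "g (fst y \<otimes> inv (fst k)) = inv e \<otimes> (snd y \<otimes> inv (snd k))"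
      using y e k eq unfolding inner_right_def by (intro mult_inv_eq_iff[THEN iffD1]) auto
  qed
  also have "\<dots> = 1 / real (card C) ^ card H / real (card C)"
    using y e k H fin by (intro prob_agrees_insert) auto
  finally show ?thesis .
qed

text \<open>If the right halves coincide, the common value of \<open>g\<close> cancels and a
  collision would force \<open>x = x'\<close>. Otherwise \<open>g\<close> is evaluated at two
  distinct fresh points, and \<open>prob_agrees_rel\<close> applies.\<close>

lemma prob_inner_left_eq_inner_left_le:
  assumes x: "x \<in> C \<times> C" "snd x \<otimes> snd k \<notin> Domain H"
    and x': "x' \<in> C \<times> C" "snd x' \<otimes> snd k \<notin> Domain H" and "x \<noteq> x'"
  shows "measure_pmf.prob unif {g. agrees H g \<and> inner_left G g k x = inner_left G g k x'}
    \<le> 1 / real (card C) ^ card H / real (card C)"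
proof (cases "snd x = snd x'")
  case True
  have "measure_pmf.prob unif {g. agrees H g \<and> inner_left G g k x = inner_left G g k x'}
      \<le> measure_pmf.prob unif {g. False}"
    using True x x' k \<open>x \<noteq> x'\<close> by (intro prob_pmf_mono)
      (auto simp: set_unif fin inner_left_def PiE_iff prod_eq_iff)
  then show ?thesis by (simp add: order_trans)
next
  case False
  have "measure_pmf.prob unif {g. agrees H g \<and> inner_left G g k x = inner_left G g k x'}
      \<le> measure_pmf.prob unif {g. agrees H g \<and> g (snd x \<otimes> snd k)
          = inv (fst x \<otimes> fst k) \<otimes> (fst x' \<otimes> fst k \<otimes> g (snd x' \<otimes> snd k))}"
  proof (rule prob_pmf_mono, safe)
    fix g assume g: "g \<in> set_pmf unif" and eq: "inner_left G g k x = inner_left G g k x'"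
    have "g (snd x \<otimes> snd k) \<in> C" "g (snd x' \<otimes> snd k) \<in> C"
      using g x x' k by (auto simp: set_unif fin PiE_iff)
    then show "g (snd x \<otimes> snd k) = inv (fst x \<otimes> fst k) \<otimes> (fst x' \<otimes> fst k \<otimes> g (snd x' \<otimes> snd k))"
      using x x' k eq[symmetric] unfolding inner_left_def
      by (intro inv_solve_left[THEN iffD2]) auto
  qed
  also have "\<dots> \<le> 1 / real (card C) ^ card H / real (card C)"
    by (rule prob_agrees_rel[where u = "snd x \<otimes> snd k" and u' = "snd x' \<otimes> snd k"
          and \<psi> = "\<lambda>v. inv (fst x \<otimes> fst k) \<otimes> (fst x' \<otimes> fst k \<otimes> v)"])
      (use x x' k H fin False in auto)
  finally show ?thesis .
qed

lemma prob_inner_right_eq_inner_right_le: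
  assumes y: "y \<in> C \<times> C" "fst y \<otimes> inv (fst k) \<notin> Domain H"
    and y': "y' \<in> C \<times> C" "fst y' \<otimes> inv (fst k) \<notin> Domain H" and "y \<noteq> y'"
  shows "measure_pmf.prob unif {g. agrees H g \<and> inner_right G g k y = inner_right G g k y'}
    \<le> 1 / real (card C) ^ card H / real (card C)"
proof (cases "fst y = fst y'")
  case True
  have "measure_pmf.prob unif {g. agrees H g \<and> inner_right G g k y = inner_right G g k y'}
      \<le> measure_pmf.prob unif {g. False}"
    using True y y' k \<open>y \<noteq> y'\<close> by (intro prob_pmf_mono)
      (auto simp: set_unif fin inner_right_def PiE_iff prod_eq_iff)
  then show ?thesis by (simp add: order_trans)
next
  case False
  have "measure_pmf.prob unif {g. agrees H g \<and> inner_right G g k y = inner_right G g k y'}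
      \<le> measure_pmf.prob unif {g. agrees H g \<and> g (fst y \<otimes> inv (fst k))
          = inv (snd y' \<otimes> inv (snd k) \<otimes> inv (g (fst y' \<otimes> inv (fst k)))) \<otimes> (snd y \<otimes> inv (snd k))}"
  proof (rule prob_pmf_mono, safe)
    fix g assume g: "g \<in> set_pmf unif" and eq: "inner_right G g k y = inner_right G g k y'"
    have "g (fst y \<otimes> inv (fst k)) \<in> C" "g (fst y' \<otimes> inv (fst k)) \<in> C"
      using g y y' k by (auto simp: set_unif fin PiE_iff)
    then show "g (fst y \<otimes> inv (fst k))
        = inv (snd y' \<otimes> inv (snd k) \<otimes> inv (g (fst y' \<otimes> inv (fst k)))) \<otimes> (snd y \<otimes> inv (snd k))"
      using y y' k eq unfolding inner_right_def by (intro mult_inv_eq_iff[THEN iffD1]) auto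
  qed
  also have "\<dots> \<le> 1 / real (card C) ^ card H / real (card C)"
    by (rule prob_agrees_rel[where u = "fst y \<otimes> inv (fst k)" and u' = "fst y' \<otimes> inv (fst k)"
          and \<psi> = "\<lambda>v. inv (snd y' \<otimes> inv (snd k) \<otimes> inv v) \<otimes> (snd y \<otimes> inv (snd k))"])
      (use y y' k H fin False in auto)
  finally show ?thesis .
qed

text \<open>Here \<open>ne\<close>, supplied by a good key, guarantees that the two sides evaluate
  \<open>g\<close> at different points, so no case distinction arises.\<close>

lemma prob_inner_left_eq_inner_right_le:
  assumes x: "x \<in> C \<times> C" "snd x \<otimes> snd k \<notin> Domain H"
    and y: "y \<in> C \<times> C" "fst y \<otimes> inv (fst k) \<notin> Domain H"
    and ne: "snd x \<otimes> snd k \<noteq> fst y \<otimes> inv (fst k)"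
  shows "measure_pmf.prob unif {g. agrees H g \<and> inner_left G g k x = inner_right G g k y}
    \<le> 1 / real (card C) ^ card H / real (card C)"
proof -
  have "measure_pmf.prob unif {g. agrees H g \<and> inner_left G g k x = inner_right G g k y}
      \<le> measure_pmf.prob unif {g. agrees H g \<and> g (snd x \<otimes> snd k)
          = inv (fst x \<otimes> fst k) \<otimes> (snd y \<otimes> inv (snd k) \<otimes> inv (g (fst y \<otimes> inv (fst k))))}"
  proof (rule prob_pmf_mono, safe)
    fix g assume g: "g \<in> set_pmf unif" and eq: "inner_left G g k x = inner_right G g k y"
    have "g (snd x \<otimes> snd k) \<in> C" "g (fst y \<otimes> inv (fst k)) \<in> C"
      using g x y k by (auto simp: set_unif fin PiE_iff)
    then show "g (snd x \<otimes> snd k)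
        = inv (fst x \<otimes> fst k) \<otimes> (snd y \<otimes> inv (snd k) \<otimes> inv (g (fst y \<otimes> inv (fst k))))"
      using x y k eq[symmetric] unfolding inner_right_def inner_left_def
      by (intro inv_solve_left[THEN iffD2]) auto
  qed
  also have "\<dots> \<le> 1 / real (card C) ^ card H / real (card C)"
    by (rule prob_agrees_rel[where u = "snd x \<otimes> snd k" and u' = "fst y \<otimes> inv (fst k)"
          and \<psi> = "\<lambda>v. inv (fst x \<otimes> fst k) \<otimes> (snd y \<otimes> inv (snd k) \<otimes> inv v)"])
      (use x y k H fin ne in auto)
  finally show ?thesis .
qed

text \<open>Union bound, jointly with agreement with \<open>H\<close>. With p and a for the sizes of
  \<open>D\<close> and \<open>E\<close>, there are 2pa possible collisions with recorded inputs of
  \<open>f\<close>, p^2 between left and right, and p^2 - p on each single side.\<close>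

lemma prob_good_function_ge:
  assumes D: "D \<subseteq> (C \<times> C) \<times> (C \<times> C)" "single_valued D" "single_valued (D\<inverse>)"
    and E: "E \<subseteq> C \<times> C" and good: "good_key G D H k"
  shows "(1 - (2 * real (card D) * real (card E) + 3 * real (card D) ^ 2 - 2 * real (card D)) / real (card C))
      / real (card C) ^ card H
    \<le> measure_pmf.prob unif {g. agrees H g \<and> good_function G D E k g}"
proof -
  define \<delta> where "\<delta> = 1 / real (card C) ^ card H / real (card C)"
  define p where "p = real (card D)"
  have finD: "finite D" "finite E"
    using D E fin by (auto intro: finite_subset)
  define l r where "l = (\<lambda>g (i :: ('a \<times> 'a) \<times> ('a \<times> 'a)). inner_left G g k (fst i))"
    and "r = (\<lambda>g (i :: ('a \<times> 'a) \<times> ('a \<times> 'a)). inner_right G g k (snd i))"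
  \<comment> \<open>Ordered pairs: every collision within one side is counted twice, hence p^2 - p
    instead of half of it.\<close>
  define J where "J = D \<times> D - Id_on D"
  have cJ: "real (card J) = p\<^sup>2 - p"
  proof -
    have "card (Id_on D) = card D"
      unfolding Id_on_def by (subst card_UN_disjoint) (use finD in auto)
    moreover have "card J = card (D \<times> D) - card (Id_on D)"
      unfolding J_def by (rule card_Diff_subset) (auto intro: finite_subset[of _ "D \<times> D"] simp: finD)
    moreover have "card D \<le> card D * card D" by (cases "card D") auto
    ultimately show ?thesis by (simp add: p_def card_cartesian_product of_nat_diff power2_eq_square)
  qed
  have mem: "fst i \<in> C \<times> C" "snd i \<in> C \<times> C" "snd (fst i) \<otimes> snd k \<notin> Domain H"
    "fst (snd i) \<otimes> inv (fst k) \<notin> Domain H" if "i \<in> D" for i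
    using that D good unfolding good_key_def by auto
  have ne: "snd (fst i) \<otimes> snd k \<noteq> fst (snd j) \<otimes> inv (fst k)" if "i \<in> D" "j \<in> D" for i j
    using that good unfolding good_key_def by blast
  \<comment> \<open>Distinct recorded pairs differ in the input and in the output, as the collision
    bounds within one side require.\<close>
  have neD: "fst i \<noteq> fst j" "snd i \<noteq> snd j" if "i \<in> D" "j \<in> D" "i \<noteq> j" for i j
    using that D(2,3) by (metis converse_iff prod.collapse single_valuedD)+
  define bad where "bad g \<longleftrightarrow> (\<exists>z\<in>D \<times> E. l g (fst z) = fst (snd z)) \<or> (\<exists>z\<in>D \<times> E. r g (fst z) = fst (snd z))
     \<or> (\<exists>z\<in>D \<times> D. l g (fst z) = r g (snd z)) \<or> (\<exists>z\<in>J. l g (fst z) = l g (snd z))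
     \<or> (\<exists>z\<in>J. r g (fst z) = r g (snd z))" for g
  have "measure_pmf.prob unif {g. agrees H g \<and> bad g}
      \<le> real (card (D \<times> E)) * \<delta> + (real (card (D \<times> E)) * \<delta> + (real (card (D \<times> D)) * \<delta>
          + (real (card J) * \<delta> + real (card J) * \<delta>)))"
    unfolding bad_def
  proof (intro prob_disj_le prob_Bex_le)
    fix z assume z: "z \<in> D \<times> E"
    show "measure_pmf.prob unif {g. agrees H g \<and> l g (fst z) = fst (snd z)} \<le> \<delta>"
      unfolding l_def \<delta>_def by (intro prob_inner_left_eq_le mem) (use z E in \<open>auto\<close>)
    show "measure_pmf.prob unif {g. agrees H g \<and> r g (fst z) = fst (snd z)} \<le> \<delta>"
      unfolding r_def \<delta>_def by (intro prob_inner_right_eq_le mem) (use z E in \<open>auto\<close>)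
  next
    fix z assume z: "z \<in> D \<times> D"
    show "measure_pmf.prob unif {g. agrees H g \<and> l g (fst z) = r g (snd z)} \<le> \<delta>"
      unfolding l_def r_def \<delta>_def by (intro prob_inner_left_eq_inner_right_le mem ne) (use z in \<open>auto\<close>)
  next
    fix z assume z: "z \<in> J"
    then have z': "fst z \<in> D" "snd z \<in> D" "fst z \<noteq> snd z"
      by (auto simp: J_def)
    show "measure_pmf.prob unif {g. agrees H g \<and> l g (fst z) = l g (snd z)} \<le> \<delta>"
      unfolding l_def \<delta>_def by (intro prob_inner_left_eq_inner_left_le mem neD z')
    show "measure_pmf.prob unif {g. agrees H g \<and> r g (fst z) = r g (snd z)} \<le> \<delta>"
      unfolding r_def \<delta>_def by (intro prob_inner_right_eq_inner_right_le mem neD z')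
  qed (use finD in \<open>auto simp: J_def\<close>)
  also have "\<dots> = (2 * p * real (card E) + 3 * p ^ 2 - 2 * p) * \<delta>"
    by (simp add: cJ card_cartesian_product p_def algebra_simps power2_eq_square)
  finally have bad: "measure_pmf.prob unif {g. agrees H g \<and> bad g} \<le> (2 * p * real (card E) + 3 * p ^ 2 - 2 * p) * \<delta>" .
  have good_if: "good_function G D E k g" if "\<not> bad g" for g
  proof -
    have "\<forall>z\<in>D \<times> E. l g (fst z) \<noteq> fst (snd z)" "\<forall>z\<in>D \<times> E. r g (fst z) \<noteq> fst (snd z)"
      "\<forall>z\<in>D \<times> D. l g (fst z) \<noteq> r g (snd z)" "\<forall>z\<in>J. l g (fst z) \<noteq> l g (snd z)"
      "\<forall>z\<in>J. r g (fst z) \<noteq> r g (snd z)"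
      using that unfolding bad_def by blast+
    note nb = this[THEN bspec, of "(_, _)", unfolded fst_conv snd_conv]
    have J: "(i, j) \<in> J" if "i \<in> D" "j \<in> D" "i \<noteq> j" for i j
      using that by (auto simp: J_def)
    show ?thesis
      unfolding good_function_def
    proof (intro conjI ballI impI)
      show "inner_left G g k (fst i) \<noteq> fst e" "inner_right G g k (snd i) \<noteq> fst e" if "i \<in> D" "e \<in> E" for i e
        using nb(1,2)[of i e] that by (simp_all add: l_def r_def)
      show "inner_left G g k (fst i) \<noteq> inner_right G g k (snd j)" if "i \<in> D" "j \<in> D" for i j
        using nb(3)[of i j] that by (simp add: l_def r_def)
      show "inner_left G g k (fst i) \<noteq> inner_left G g k (fst j)"
        "inner_right G g k (snd i) \<noteq> inner_right G g k (snd j)" if "i \<in> D" "j \<in> D" "i \<noteq> j" for i j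
        using nb(4,5)[of i j] J[OF that] by (simp_all add: l_def r_def)
    qed
  qed
  have "1 / real (card C) ^ card H = measure_pmf.prob unif {g. agrees H g}"
    using H fin by (subst prob_agrees) auto
  also have "\<dots> \<le> measure_pmf.prob unif {g. agrees H g \<and> good_function G D E k g \<or> agrees H g \<and> bad g}"
    using good_if by (intro prob_pmf_mono) blast
  also have "\<dots> \<le> measure_pmf.prob unif {g. agrees H g \<and> good_function G D E k g}
      + measure_pmf.prob unif {g. agrees H g \<and> bad g}"
    unfolding Collect_disj_eq by (rule measure_Un_le) auto
  finally have "1 / real (card C) ^ card H - (2 * p * real (card E) + 3 * p ^ 2 - 2 * p) * \<delta>
      \<le> measure_pmf.prob unif {g. agrees H g \<and> good_function G D E k g}"
    using bad by linarith
  moreover have "(1 - c / real (card C)) / real (card C) ^ card H = 1 / real (card C) ^ card H - c * \<delta>" for c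
    by (simp add: \<delta>_def diff_divide_distrib mult.commute)
  ultimately show ?thesis by (simp add: p_def)
qed

end

section \<open>Probability that a random key is good\<close>

text \<open>The vacuous conjunct matches the shape of \<open>prob_Bex_le\<close> and \<open>prob_disj_le\<close>.\<close>

lemma prob_key_le:
  assumes "finite C" "inj_on fst {k \<in> C \<times> C. P k} \<or> inj_on snd {k \<in> C \<times> C. P k}"
  shows "measure_pmf.prob (pmf_of_set (C \<times> C)) {k. True \<and> P k} \<le> 1 / real (card C)"
proof -
  let ?B = "{k \<in> C \<times> C. P k}"
  have "card ?B \<le> card C"
    using assms(2)
  proof
    assume "inj_on fst ?B"
    then show ?thesis by (rule card_inj_on_le) (use assms(1) in auto)
  next
    assume "inj_on snd ?B"
    then show ?thesis by (rule card_inj_on_le) (use assms(1) in auto)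
  qed
  moreover have "(C \<times> C) \<inter> {k. True \<and> P k} = ?B" by auto
  moreover have "card C > 0" using assms(1) by (auto simp: card_gt_0_iff)
  moreover have "C \<times> C \<noteq> {}" by auto
  ultimately show ?thesis
    using assms(1) by (simp add: measure_pmf_of_set card_cartesian_product divide_simps)
qed

lemma left_cancelD: "a \<otimes> b = a \<otimes> c \<Longrightarrow> a \<in> C \<Longrightarrow> b \<in> C \<Longrightarrow> c \<in> C \<Longrightarrow> b = c"
  by simp

text \<open>Cancellation determines \<open>snd k\<close> from \<open>fst k\<close>, which leaves at
  most N of the N^2 keys. Letting the right-hand side depend on \<open>fst k\<close> covers the
  clashes between the two outer rounds as well.\<close>

lemma inj_on_fst_solutions:
  assumes "a \<in> C"
  shows "inj_on fst {k \<in> C \<times> C. a \<otimes> snd k = w (fst k)}"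
proof (rule inj_onI)
  fix k k' assume k: "k \<in> {k \<in> C \<times> C. a \<otimes> snd k = w (fst k)}"
    "k' \<in> {k \<in> C \<times> C. a \<otimes> snd k = w (fst k)}" "fst k = fst k'"
  then have "a \<otimes> snd k = a \<otimes> snd k'" by simp
  then have "snd k = snd k'"
    by (rule left_cancelD) (use assms k in \<open>simp_all add: mem_Times_iff\<close>)
  with k(3) show "k = k'" by (rule prod_eqI)
qed

lemma inj_on_snd_solutions:
  assumes "a \<in> C"
  shows "inj_on snd {k \<in> C \<times> C. a \<otimes> inv (fst k) = e}"
proof (rule inj_onI)
  fix k k' assume k: "k \<in> {k \<in> C \<times> C. a \<otimes> inv (fst k) = e}"
    "k' \<in> {k \<in> C \<times> C. a \<otimes> inv (fst k) = e}" "snd k = snd k'"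
  then have "a \<otimes> inv (fst k) = a \<otimes> inv (fst k')" by simp
  then have "inv (fst k) = inv (fst k')"
    by (rule left_cancelD) (use assms k in \<open>simp_all add: mem_Times_iff\<close>)
  then have "fst k = fst k'"
    by (rule inj_onD[OF inv_inj]) (use k in \<open>simp_all add: mem_Times_iff\<close>)
  then show "k = k'" using k(3) by (rule prod_eqI)
qed

text \<open>Union bound: p b clashes of first-round inputs with \<open>H\<close>, as many for the
  last round, and p^2 between the rounds, where p and b are the sizes of \<open>D\<close> and
  \<open>H\<close>. Each spoils at most a fraction 1/N of the keys.\<close>

lemma prob_good_key_ge:
  assumes fin: "finite C" and D: "D \<subseteq> (C \<times> C) \<times> (C \<times> C)" and H: "H \<subseteq> C \<times> C"
  shows "1 - (2 * real (card D) * real (card H) + real (card D) ^ 2) / real (card C)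
    \<le> measure_pmf.prob (pmf_of_set (C \<times> C)) {k. good_key G D H k}"
proof -
  let ?K = "pmf_of_set (C \<times> C)"
  have K: "set_pmf ?K = C \<times> C"
    using fin by (intro set_pmf_of_set) auto
  have finD: "finite D" "finite H"
    using D H fin by (auto intro: finite_subset)
  define bad where "bad k \<longleftrightarrow> (\<exists>z\<in>D \<times> H. snd (fst (fst z)) \<otimes> snd k = fst (snd z))
     \<or> (\<exists>z\<in>D \<times> H. fst (snd (fst z)) \<otimes> inv (fst k) = fst (snd z))
     \<or> (\<exists>z\<in>D \<times> D. snd (fst (fst z)) \<otimes> snd k = fst (snd (snd z)) \<otimes> inv (fst k))" for k
  have "measure_pmf.prob ?K {k. True \<and> bad k}
      \<le> real (card (D \<times> H)) * (1 / real (card C)) + (real (card (D \<times> H)) * (1 / real (card C))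
          + real (card (D \<times> D)) * (1 / real (card C)))"
    unfolding bad_def
  proof (intro prob_disj_le prob_Bex_le prob_key_le)
    fix z assume "z \<in> D \<times> H"
    then have z: "snd (fst (fst z)) \<in> C" "fst (snd (fst z)) \<in> C" "fst (snd z) \<in> C"
      using D H by auto
    show "inj_on fst {k \<in> C \<times> C. snd (fst (fst z)) \<otimes> snd k = fst (snd z)}
        \<or> inj_on snd {k \<in> C \<times> C. snd (fst (fst z)) \<otimes> snd k = fst (snd z)}"
      by (intro disjI1 inj_on_fst_solutions z)
    show "inj_on fst {k \<in> C \<times> C. fst (snd (fst z)) \<otimes> inv (fst k) = fst (snd z)}
        \<or> inj_on snd {k \<in> C \<times> C. fst (snd (fst z)) \<otimes> inv (fst k) = fst (snd z)}"
      by (intro disjI2 inj_on_snd_solutions z)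
  next
    fix z assume "z \<in> D \<times> D"
    then have z: "snd (fst (fst z)) \<in> C" "fst (snd (snd z)) \<in> C"
      using D by auto
    show "inj_on fst {k \<in> C \<times> C. snd (fst (fst z)) \<otimes> snd k = fst (snd (snd z)) \<otimes> inv (fst k)}
        \<or> inj_on snd {k \<in> C \<times> C. snd (fst (fst z)) \<otimes> snd k = fst (snd (snd z)) \<otimes> inv (fst k)}"
      by (intro disjI1 inj_on_fst_solutions z)
  qed (use finD fin in auto)
  also have "\<dots> = (2 * real (card D) * real (card H) + real (card D) ^ 2) / real (card C)"
    by (simp add: card_cartesian_product power2_eq_square add_divide_distrib)
  finally have bad: "measure_pmf.prob ?K {k. True \<and> bad k}
      \<le> (2 * real (card D) * real (card H) + real (card D) ^ 2) / real (card C)" .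
  have good_if: "good_key G D H k" if "\<not> bad k" for k
  proof -
    have "\<forall>z\<in>D \<times> H. snd (fst (fst z)) \<otimes> snd k \<noteq> fst (snd z)"
      "\<forall>z\<in>D \<times> H. fst (snd (fst z)) \<otimes> inv (fst k) \<noteq> fst (snd z)"
      "\<forall>z\<in>D \<times> D. snd (fst (fst z)) \<otimes> snd k \<noteq> fst (snd (snd z)) \<otimes> inv (fst k)"
      using that unfolding bad_def by blast+
    note nb = this[THEN bspec, of "(_, _)", unfolded fst_conv snd_conv]
    show ?thesis
      unfolding good_key_def
    proof (intro conjI ballI notI)
      show False if "i \<in> D" "snd (fst i) \<otimes> snd k \<in> Domain H" for i
        using that(2) nb(1)[of i] that(1) by (elim DomainE) fastforce
      show False if "i \<in> D" "fst (snd i) \<otimes> inv (fst k) \<in> Domain H" for i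
        using that(2) nb(2)[of i] that(1) by (elim DomainE) fastforce
      show False if "i \<in> D" "j \<in> D" "snd (fst i) \<otimes> snd k = fst (snd j) \<otimes> inv (fst k)" for i j
        using that nb(3)[of i j] by simp
    qed
  qed
  have "1 = measure_pmf.prob ?K {k. True}" by simp
  also have "\<dots> \<le> measure_pmf.prob ?K {k. good_key G D H k \<or> True \<and> bad k}"
    using good_if by (intro prob_pmf_mono) blast
  also have "\<dots> \<le> measure_pmf.prob ?K {k. good_key G D H k} + measure_pmf.prob ?K {k. True \<and> bad k}"
    unfolding Collect_disj_eq by (rule measure_Un_le) auto
  finally show ?thesis using bad by linarith
qed

end

subsection \<open>Comparison of the two games\<close>

text \<open>Passing to the supports makes both factors countable, as
  \<open>measure_pmf_prob_product\<close> requires.\<close>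

lemma prob_pair_pmf_Times:
  "measure_pmf.prob (pair_pmf M N) (A \<times> B) = measure_pmf.prob M A * measure_pmf.prob N B"
proof -
  have "measure_pmf.prob (pair_pmf M N) (A \<times> B)
      = measure_pmf.prob (pair_pmf M N) ((A \<inter> set_pmf M) \<times> (B \<inter> set_pmf N))"
    by (subst measure_Int_set_pmf[symmetric]) (simp add: Times_Int_Times)
  also have "\<dots> = measure_pmf.prob M (A \<inter> set_pmf M) * measure_pmf.prob N (B \<inter> set_pmf N)"
    by (rule measure_pmf_prob_product) (auto intro: countable_subset[OF _ countable_set_pmf])
  finally show ?thesis by (simp add: measure_Int_set_pmf)
qed

lemma pair_pmf_of_set:
  assumes "finite A" "A \<noteq> {}" "finite B" "B \<noteq> {}"
  shows "pair_pmf (pmf_of_set A) (pmf_of_set B) = pmf_of_set (A \<times> B)"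
proof (rule pmf_eqI)
  fix z
  show "pmf (pair_pmf (pmf_of_set A) (pmf_of_set B)) z = pmf (pmf_of_set (A \<times> B)) z"
    using assms by (cases z) (simp add: pmf_pair pmf_of_set indicator_def card_cartesian_product)
qed

section \<open>The two games as distributions over worlds\<close>

definition random_world where
  "random_world G = pair_pmf (random_function G) (pair_pmf (random_function G) (random_permutation G))"

text \<open>The order of the draws is that of the estimates: whether \<open>g\<close> is good
  depends on the key, and the prescribed values of \<open>f\<close> depend on both.\<close>

definition Psi_world where
  "Psi_world G = do {
     k \<leftarrow> pmf_of_set (carrier (G \<times>\<times> G));
     g \<leftarrow> random_function G;
     map_pmf (\<lambda>f. (f, g, Psi G f g k)) (random_function G)
   }"

lemma random_game_eq: "random_game G A = bind_pmf (random_world G) (play G A)"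
  by (simp add: random_game_def random_world_def play_def pair_pmf_def bind_assoc_pmf bind_return_pmf)

text \<open>Independent draws commute, so \<open>f\<close> and then \<open>g\<close> can be moved
  behind the two subkeys.\<close>

lemma Psi_game_eq:
  assumes "finite (carrier G)" "carrier G \<noteq> {}"
  shows "Psi_game G A = bind_pmf (Psi_world G) (play G A)"
proof -
  let ?F = "random_function G" and ?K = "pmf_of_set (carrier G)"
  define W where "W = (\<lambda>f g kL kR. play G A (f, g, Psi G f g (kL, kR)))"
  have key: "pmf_of_set (carrier (G \<times>\<times> G)) = bind_pmf ?K (\<lambda>kL. bind_pmf ?K (\<lambda>kR. return_pmf (kL, kR)))"
    using assms by (simp add: pair_pmf_def[symmetric] pair_pmf_of_set)
  have "Psi_game G A = bind_pmf ?F (\<lambda>f. bind_pmf ?F (\<lambda>g. bind_pmf ?K (\<lambda>kL. bind_pmf ?K (W f g kL))))"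
    by (simp add: Psi_game_def W_def play_def Let_def)
  also have "\<dots> = bind_pmf ?F (\<lambda>g. bind_pmf ?F (\<lambda>f. bind_pmf ?K (\<lambda>kL. bind_pmf ?K (W f g kL))))"
    by (rule bind_commute_pmf)
  also have "\<dots> = bind_pmf ?F (\<lambda>g. bind_pmf ?K (\<lambda>kL. bind_pmf ?F (\<lambda>f. bind_pmf ?K (W f g kL))))"
    by (subst bind_commute_pmf) (rule refl)
  also have "\<dots> = bind_pmf ?F (\<lambda>g. bind_pmf ?K (\<lambda>kL. bind_pmf ?K (\<lambda>kR. bind_pmf ?F (\<lambda>f. W f g kL kR))))"
    by (intro bind_pmf_cong refl) (rule bind_commute_pmf)
  also have "\<dots> = bind_pmf ?K (\<lambda>kL. bind_pmf ?F (\<lambda>g. bind_pmf ?K (\<lambda>kR. bind_pmf ?F (\<lambda>f. W f g kL kR))))"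
    by (rule bind_commute_pmf)
  also have "\<dots> = bind_pmf ?K (\<lambda>kL. bind_pmf ?K (\<lambda>kR. bind_pmf ?F (\<lambda>g. bind_pmf ?F (\<lambda>f. W f g kL kR))))"
    by (intro bind_pmf_cong refl) (rule bind_commute_pmf)
  also have "\<dots> = bind_pmf (Psi_world G) (play G A)"
    unfolding Psi_world_def key by (simp add: bind_assoc_pmf bind_return_pmf bind_map_pmf W_def)
  finally show ?thesis .
qed

lemma consistent_eq_Times:
  "consistent D E H = {f. agrees E f} \<times> {g. agrees H g} \<times> {P. agrees D P}"
  by (auto simp: consistent_def)

section \<open>Transcript probabilities in the two worlds\<close>

context group begin

lemma set_random_permutation:
  "finite C \<Longrightarrow> set_pmf (random_permutation G) = {R. R permutes carrier (G \<times>\<times> G)}"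
  unfolding random_permutation_def
  by (rule set_pmf_of_set) (auto simp: finite_permutations intro: permutes_id)

lemma set_random_function: "finite C \<Longrightarrow> set_pmf (random_function G) = (C \<rightarrow>\<^sub>E C)"
  unfolding random_function_def by (rule set_unif)

lemma random_world_in_worlds:
  assumes "finite C"
  shows "finite (set_pmf (random_world G))" "set_pmf (random_world G) \<subseteq> worlds G"
proof -
  have "finite (carrier (G \<times>\<times> G))" using assms by simp
  then show "finite (set_pmf (random_world G))"
    unfolding random_world_def set_pair_pmf set_random_function[OF assms] set_random_permutation[OF assms]
    by (intro finite_cartesian_product finite_PiE finite_permutations assms)
  show "set_pmf (random_world G) \<subseteq> worlds G"
    using assms unfolding random_world_def worlds_def
    by (auto simp: set_random_function set_random_permutation
        simp del: carrier_DirProd intro: permutes_imp_bij)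
qed

lemma Psi_world_in_worlds:
  assumes "finite C"
  shows "finite (set_pmf (Psi_world G))" "set_pmf (Psi_world G) \<subseteq> worlds G"
proof -
  have K: "set_pmf (pmf_of_set (carrier (G \<times>\<times> G))) = carrier (G \<times>\<times> G)"
    using assms by (intro set_pmf_of_set) auto
  show "finite (set_pmf (Psi_world G))"
    unfolding Psi_world_def
    using assms by (simp add: K set_random_function finite_PiE del: carrier_DirProd) (simp add: finite_PiE)
  have "bij_betw (Psi G f g k) (carrier (G \<times>\<times> G)) (carrier (G \<times>\<times> G))"
    if "f \<in> C \<rightarrow>\<^sub>E C" "g \<in> C \<rightarrow>\<^sub>E C" "k \<in> carrier (G \<times>\<times> G)" for f g k
    using that by (intro bij_betw_Psi group_axioms) auto
  then show "set_pmf (Psi_world G) \<subseteq> worlds G"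
    unfolding Psi_world_def worlds_def
    using assms by (auto simp: K set_random_function simp del: carrier_DirProd)
qed

lemma prob_random_world_le:
  fixes D E H
  defines "n \<equiv> (card C)\<^sup>2"
  assumes fin: "finite C" and D: "D \<subseteq> (C \<times> C) \<times> (C \<times> C)" and E: "E \<subseteq> C \<times> C" and H: "H \<subseteq> C \<times> C"
  shows "measure_pmf.prob (random_world G) (consistent D E H)
    \<le> 1 / real (card C) ^ (card E + card H) * (fact (n - card D) / fact n)"
proof -
  have n: "card (C \<times> C) = n" by (simp add: n_def card_cartesian_product power2_eq_square)
  have "measure_pmf.prob (random_world G) (consistent D E H)
      = measure_pmf.prob unif {f. agrees E f}
        * (measure_pmf.prob unif {g. agrees H g}
          * measure_pmf.prob (pmf_of_set {R. R permutes C \<times> C}) {P. agrees D P})"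
    by (simp add: random_world_def consistent_eq_Times prob_pair_pmf_Times random_function_def
        random_permutation_def)
  also have "\<dots> \<le> 1 / real (card C) ^ card E * (1 / real (card C) ^ card H * (fact (n - card D) / fact n))"
    using assms prob_permutation_agrees_le[of "C \<times> C" D]
    by (intro mult_mono prob_agrees_le mult_nonneg_nonneg) (auto simp: n)
  finally show ?thesis by (simp add: power_add)
qed

text \<open>Multiplies the bounds for the three successive draws. The assumption
  \<open>\<delta> \<le> 1\<close> keeps the intermediate lower bound nonnegative, as
  \<open>prob_bind_pmf_ge\<close> demands.\<close>

lemma prob_Psi_world_ge:
  fixes D E H
  defines "N \<equiv> real (card C)" and "p \<equiv> real (card D)"
  defines "\<kappa> \<equiv> (2 * p * real (card H) + p\<^sup>2) / N"
    and "\<delta> \<equiv> (2 * p * real (card E) + 3 * p\<^sup>2 - 2 * p) / N"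
  assumes fin: "finite C"
    and D: "D \<subseteq> (C \<times> C) \<times> (C \<times> C)" "single_valued D" "single_valued (D\<inverse>)"
    and E: "E \<subseteq> C \<times> C" "single_valued E" and H: "H \<subseteq> C \<times> C" "single_valued H"
    and "\<delta> \<le> 1"
  shows "(1 - \<kappa>) * (1 - \<delta>) / N ^ (card E + card H + 2 * card D)
    \<le> measure_pmf.prob (Psi_world G) (consistent D E H)"
proof -
  \<comment> \<open>\<open>c\<close> bounds the draw of \<open>f\<close> once \<open>g\<close> is
    good, \<open>d\<close> the draw of \<open>g\<close> and \<open>f\<close> once the key is
    good.\<close>
  define c where "c = 1 / N ^ (card E + 2 * card D)"
  define d where "d = c * ((1 - \<delta>) / N ^ card H)"
  have c: "0 \<le> c" and d: "0 \<le> d" using \<open>\<delta> \<le> 1\<close> by (auto simp: c_def d_def N_def)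
  have K: "set_pmf (pmf_of_set (C \<times> C)) = C \<times> C"
    using fin by (intro set_pmf_of_set) auto
  have "d * (1 - \<kappa>) \<le> d * measure_pmf.prob (pmf_of_set (C \<times> C)) {k. good_key G D H k}"
    using d prob_good_key_ge[OF fin D(1) H(1)] by (intro mult_left_mono) (auto simp: \<kappa>_def p_def N_def)
  also have "\<dots> \<le> measure_pmf.prob (Psi_world G) (consistent D E H)"
    unfolding Psi_world_def carrier_DirProd
  proof (rule prob_bind_pmf_ge)
    fix k assume k: "k \<in> set_pmf (pmf_of_set (C \<times> C))" and good: "good_key G D H k"
    have "d \<le> c * measure_pmf.prob unif {g. agrees H g \<and> good_function G D E k g}"
      using prob_good_function_ge[OF fin H _ D E(1) good] k c unfolding d_def
      by (intro mult_left_mono) (auto simp: \<delta>_def p_def N_def K)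
    also have "\<dots> \<le> measure_pmf.prob (bind_pmf unif (\<lambda>g. map_pmf (\<lambda>f. (f, g, Psi G f g k)) unif)) (consistent D E H)"
    proof (rule prob_bind_pmf_ge)
      fix g assume "g \<in> set_pmf unif" and g: "agrees H g \<and> good_function G D E k g"
      then have "c \<le> measure_pmf.prob unif {f. agrees E f \<and> agrees D (Psi G f g k)}"
        unfolding c_def N_def using k by (intro prob_Psi_agrees_ge fin D E) (auto simp: K set_unif fin)
      also have "{f. agrees E f \<and> agrees D (Psi G f g k)}
          = (\<lambda>f. (f, g, Psi G f g k)) -` consistent D E H"
        using g by (auto simp: consistent_def)
      finally show "c \<le> measure_pmf.prob (map_pmf (\<lambda>f. (f, g, Psi G f g k)) unif) (consistent D E H)"
        by simp
    qed (rule c)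
    finally show "d \<le> measure_pmf.prob (bind_pmf (random_function G)
        (\<lambda>g. map_pmf (\<lambda>f. (f, g, Psi G f g k)) (random_function G))) (consistent D E H)"
      by (simp add: random_function_def)
  qed (rule d)
  finally show ?thesis
    by (simp add: d_def c_def power_add mult_ac)
qed

text \<open>Three losses add up: \<open>\<kappa>\<close> for bad keys, \<open>\<delta>\<close> for
  bad \<open>g\<close>, and \<open>\<eta>\<close> for replacing the falling factorial of N^2 by a
  power of it.\<close>

lemma prob_random_world_le_prob_Psi_world:
  fixes D E H q
  defines "N \<equiv> real (card C)"
  assumes fin: "finite C"
    and D: "D \<subseteq> (C \<times> C) \<times> (C \<times> C)" and E: "E \<subseteq> C \<times> C" and H: "H \<subseteq> C \<times> C"
    and q: "card D + card E + card H \<le> q"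
  shows "(1 - (2 * (3 * real q ^ 2 - 2 * real q) / N + (real q ^ 2 - real q) / N ^ 2))
      * measure_pmf.prob (random_world G) (consistent D E H)
    \<le> measure_pmf.prob (Psi_world G) (consistent D E H)" (is "(1 - ?\<epsilon>) * ?I \<le> ?R")
\<comment> \<open>In either case the left-hand side is at most 0. Otherwise some ideal world
  realises the transcript, which makes all three relations single-valued and \<open>D\<close>
  injective.\<close>
proof (cases "?\<epsilon> \<ge> 1 \<or> ?I = 0")
  case True
  then have "(1 - ?\<epsilon>) * ?I \<le> 0" by (auto simp: mult_nonpos_nonneg)
  then show ?thesis by (rule order_trans) simp
next
  case False
  then obtain f g R where R: "(f, g, R) \<in> set_pmf (random_world G)" "agrees D R" "agrees E f" "agrees H g"
    by (fastforce simp: measure_pmf_zero_iff consistent_def)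
  then have "R permutes C \<times> C"
    using fin by (simp add: random_world_def set_random_permutation)
  have sv: "single_valued D" "single_valued E" "single_valued H"
    using R by (auto intro: single_valued_if_agrees)
  have sv': "single_valued (D\<inverse>)"
  proof (rule single_valuedI)
    fix y x x' assume "(y, x) \<in> D\<inverse>" "(y, x') \<in> D\<inverse>"
    then have "R x = R x'" using agreesD[OF R(2)] by simp
    then show "x = x'" using permutes_inj[OF \<open>R permutes C \<times> C\<close>] by (simp add: inj_eq)
  qed
  define n where "n = (card C)\<^sup>2"
  define p a b where "p = real (card D)" and "a = real (card E)" and "b = real (card H)"
  have "finite D" using D fin by (auto intro: finite_subset)
  have N: "N \<ge> 1" using fin by (auto simp: N_def Suc_le_eq card_gt_0_iff)
  have nN: "real n = N ^ 2" by (simp add: n_def N_def)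
  have pn: "card D \<le> n"
  proof -
    have "card (Domain D) \<le> card (C \<times> C)"
      using D fin by (intro card_mono) auto
    then show ?thesis
      using card_eq_card_Domain[OF sv(1)] by (simp add: n_def card_cartesian_product power2_eq_square)
  qed
  define \<kappa> \<delta> \<eta> where "\<kappa> = (2 * p * b + p\<^sup>2) / N" and "\<delta> = (2 * p * a + 3 * p\<^sup>2 - 2 * p) / N"
    and "\<eta> = p * (p - 1) / n"
  have pp: "p * (p - 1) \<ge> 0" by (cases "card D") (auto simp: p_def)
  have nonneg: "0 \<le> \<kappa>" "0 \<le> \<delta>" "0 \<le> \<eta>"
  proof -
    have "0 \<le> 2 * p * a" "0 \<le> 2 * p * b" "0 \<le> p\<^sup>2" by (auto simp: p_def a_def b_def)
    moreover have "3 * p\<^sup>2 - 2 * p = p\<^sup>2 + 2 * (p * (p - 1))" by (simp add: algebra_simps power2_eq_square)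
    ultimately have "0 \<le> 2 * p * b + p\<^sup>2" "0 \<le> 2 * p * a + 3 * p\<^sup>2 - 2 * p"
      using pp by linarith+
    then show "0 \<le> \<kappa>" "0 \<le> \<delta>" "0 \<le> \<eta>"
      unfolding \<kappa>_def \<delta>_def \<eta>_def using N pp by (intro divide_nonneg_nonneg; simp)+
  qed
  have pq: "0 \<le> p" "p + a + b \<le> real q" "0 \<le> a" "0 \<le> b"
    using q by (auto simp: p_def a_def b_def simp flip: of_nat_add)
  have qq: "real q \<le> (real q)\<^sup>2" by (cases q) (auto simp: power2_eq_square)
  have mono: "p * (p - 1) \<le> (real q)\<^sup>2 - real q"
  \<comment> \<open>The empty transcript is separate because p - 1 is negative there, so the
    factorwise comparison fails.\<close>
  proof (cases "card D")
    case 0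
    then show ?thesis using qq by (simp add: p_def)
  next
    case (Suc m)
    then have "p * (p - 1) \<le> real q * (real q - 1)"
      using pq by (intro mult_mono) (auto simp: p_def)
    then show ?thesis by (simp add: algebra_simps power2_eq_square)
  qed
  have "\<kappa> + \<delta> + \<eta> \<le> ?\<epsilon>"
  proof -
    \<comment> \<open>The numerators of \<open>\<kappa>\<close> and \<open>\<delta>\<close> add up
      to 2p(p + a + b) + 2p(p - 1), which is at most 2q^2 + 2(q^2 - q). The stated 6q^2 - 4q exceeds
      this by 2(q^2 - q), which is nonnegative.\<close>
    have "p * (p + a + b) \<le> real q * real q"
      using pq by (intro mult_mono) auto
    then have "(2 * p * b + p\<^sup>2) + (2 * p * a + 3 * p\<^sup>2 - 2 * p) \<le> 2 * (3 * (real q)\<^sup>2 - 2 * real q)"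
      using mono qq by (simp add: algebra_simps power2_eq_square)
    then have "\<kappa> + \<delta> \<le> 2 * (3 * (real q)\<^sup>2 - 2 * real q) / N"
      using N unfolding \<kappa>_def \<delta>_def add_divide_distrib[symmetric] by (intro divide_right_mono) auto
    moreover have "\<eta> \<le> ((real q)\<^sup>2 - real q) / N ^ 2"
      using mono unfolding \<eta>_def nN by (intro divide_right_mono) auto
    ultimately show ?thesis by linarith
  qed
  moreover have "\<kappa> + \<delta> + \<eta> < 1"
    using calculation False by linarith
  ultimately have small: "\<kappa> \<le> 1" "\<delta> \<le> 1" "\<eta> \<le> 1"
    and eps: "1 - ?\<epsilon> \<le> 1 - (\<kappa> + \<delta> + \<eta>)"
    using nonneg by linarith+
  define t where "t = 1 / N ^ (card E + card H)"
  have prod: "1 - (\<kappa> + \<delta> + \<eta>) \<le> (1 - \<kappa>) * (1 - \<delta>) * (1 - \<eta>)"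
  proof -
    have "1 - (\<kappa> + \<delta>) \<le> (1 - \<kappa>) * (1 - \<delta>)"
      using nonneg by (simp add: algebra_simps)
    then have "(1 - (\<kappa> + \<delta>)) * (1 - \<eta>) \<le> (1 - \<kappa>) * (1 - \<delta>) * (1 - \<eta>)"
      using small by (intro mult_right_mono) auto
    moreover have "(1 - (\<kappa> + \<delta>)) * (1 - \<eta>) = 1 - (\<kappa> + \<delta> + \<eta>) + (\<kappa> + \<delta>) * \<eta>"
      by (simp add: algebra_simps)
    moreover have "0 \<le> (\<kappa> + \<delta>) * \<eta>" using nonneg by simp
    ultimately show ?thesis by linarith
  qed
  have "(1 - ?\<epsilon>) * ?I \<le> ((1 - \<kappa>) * (1 - \<delta>) * (1 - \<eta>)) * ?I"
    using eps prod by (intro mult_right_mono) auto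
  also have "\<dots> \<le> ((1 - \<kappa>) * (1 - \<delta>) * (1 - \<eta>)) * (t * (fact (n - card D) / fact n))"
    using prob_random_world_le[OF fin D E H] small unfolding t_def n_def N_def
    by (intro mult_left_mono) auto
  also have "\<dots> = ((1 - \<kappa>) * (1 - \<delta>) * t) * ((1 - \<eta>) * (fact (n - card D) / fact n))"
    by simp
  also have "\<dots> \<le> ((1 - \<kappa>) * (1 - \<delta>) * t) * (1 / real n ^ card D)"
  proof (rule mult_left_mono)
    have "n > 0" using nN N by (cases n) auto
    then show "(1 - \<eta>) * (fact (n - card D) / fact n) \<le> 1 / real n ^ card D"
      using fact_quotient_le[OF pn] by (simp add: \<eta>_def p_def)
    show "0 \<le> (1 - \<kappa>) * (1 - \<delta>) * t"
      using small N by (simp add: t_def)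
  qed
  also have "\<dots> = (1 - \<kappa>) * (1 - \<delta>) / N ^ (card E + card H + 2 * card D)"
    by (simp add: t_def nN power_add power_mult)
  also have "\<dots> \<le> ?R"
    using prob_Psi_world_ge[OF fin D sv(1) sv' E sv(2) H sv(3)] small
    unfolding \<kappa>_def \<delta>_def N_def p_def a_def b_def by blast
  finally show ?thesis .
qed

end

theorem theorem45:
  fixes G :: "('g, 'm) monoid_scheme" and A :: "'g algorithm" and q :: nat
  assumes "group G" and "finite (carrier G)"
    and "adversary G q A"
  shows "\<bar>pmf (Psi_game G A) True - pmf (random_game G A) True\<bar>
     \<le> 2 * (3 * real q ^ 2 - 2 * real q) / real (card (carrier G))
       + (real q ^ 2 - real q) / real (card (carrier G)) ^ 2"
proof -
  interpret group G by fact
  \<comment> \<open>\<open>H_coefficient\<close> asks for a nonnegative bound; this follows from q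
    <= q^2 for natural q.\<close>
  have "real q \<le> real q ^ 2" by (cases q) (auto simp: power2_eq_square)
  moreover have "0 \<le> real q" by simp
  ultimately have "0 \<le> 2 * (3 * real q ^ 2 - 2 * real q)" "0 \<le> real q ^ 2 - real q"
    by argo+
  then have "0 \<le> 2 * (3 * real q ^ 2 - 2 * real q) / real (card (carrier G))
      + (real q ^ 2 - real q) / real (card (carrier G)) ^ 2"
    by (intro add_nonneg_nonneg divide_nonneg_nonneg zero_le_power of_nat_0_le_iff)
  then show ?thesis
    unfolding random_game_eq Psi_game_eq[OF assms(2) carrier_not_empty]
    using assms
    by (intro H_coefficient random_world_in_worlds Psi_world_in_worlds
        prob_random_world_le_prob_Psi_world) auto
qed

end
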